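(* (Alternative form of the Gelfand–Naimark theorem) For any $\mathbb{H}$-$B^*$-algebra $A$, there exist a Hilbert $\mathbb{H}$-bimodule $H$ and an isometric $\mathbb{H}$-$*$-homomorphism from $A$ to $\mathcal{L}_{\mathbb{R}}(H)$.
   Context: $\mathbb{H}$ denotes the real quaternions with conjugation $^*$ and the Euclidean norm; $\mathbb{R}$ is identified with its center. An $\mathbb{H}$-vector space is a unital $\mathbb{H}$-bimodule $X$ with $rx=xr$ for $r\in\mathbb{R}$; an $\mathbb{H}$-normed space is an $\mathbb{H}$-vector space with a norm satisfying $\|\alpha x\beta\|\le\|\alpha\|\|x\|\|\beta\|$. An $\mathbb{H}$-algebra is an $\mathbb{H}$-vector space $A$ that is also an $\mathbb{R}$-algebra (for the induced real vector space structure; no unit required) with $(\gamma a)b=\gamma(ab)$, $(a\gamma)b=a(\gamma b)$, $(ab)\gamma=a(b\gamma)$ for $a,b\in A$, $\gamma\in\mathbb{H}$. An $\mathbb{H}$-involution on $A$ is a (real) involution with $(\alpha b)^*=b^*\alpha^*$ and $(b\alpha)^*=\alpha^*b^*$ for $\alpha\in\mathbb{H}$, $b\in A$. An $\mathbb{H}$-$B^*$-algebra is an $\mathbb{H}$-algebra with $\mathbb{H}$-involution and a norm making it a complete $\mathbb{H}$-normed space with $\|ab\|\le\|a\|\|b\|$ and $\|a^*a\|=\|a\|^2$. An $\mathbb{H}$-$*$-homomorphism is an $\mathbb{H}$-bimodule map that is multiplicative and $*$-preserving. An $\mathbb{H}$-valued inner product on a right $\mathbb{H}$-module $Y$ is a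 map $\langle\cdot,\cdot\rangle:Y\times Y\to\mathbb{H}$ with $\langle x,y+z\beta\rangle=\langle x,y\rangle+\langle x,z\rangle\beta$, $\langle y,x\rangle=\langle x,y\rangle^*$, $\langle x,x\rangle\ge0$, and $\langle x,x\rangle=0$ implies $x=0$. A Hilbert $\mathbb{H}$-bimodule is an $\mathbb{H}$-vector space $Y$ with an $\mathbb{H}$-valued inner product such that $\langle\alpha x,y\rangle=\langle x,\alpha^*y\rangle$ for $x,y\in Y$, $\alpha\in\mathbb{H}$, and which is complete under $\|y\|=\sqrt{\|\langle y,y\rangle\|}$. Such a $Y$ is a real Hilbert space under the real part of $\langle\cdot,\cdot\rangle$ (with the same norm), and $\mathcal{L}_{\mathbb{R}}(Y)$ is the algebra of bounded $\mathbb{R}$-linear operators on it, with operator norm and real Hilbert space adjoint. It is an $\mathbb{H}$-$B^*$-algebra with scalar multiplications $\alpha T=\Theta(\alpha)T$, $T\alpha=T\Theta(\alpha)$, where $\Theta(\alpha)$ is left multiplication by $\alpha$ on $Y$. *)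

theory Defs
  imports "HOL-Analysis.Analysis"
begin

section \<open>The real quaternions\<close>

datatype quat = Quat (qRe: real) (qIm1: real) (qIm2: real) (qIm3: real)

lemma quat_eq_iff:
  "p = q \<longleftrightarrow> qRe p = qRe q \<and> qIm1 p = qIm1 q \<and> qIm2 p = qIm2 q \<and> qIm3 p = qIm3 q"
  by (cases p; cases q) simp

instantiation quat :: real_vector
begin

definition zero_quat :: quat where "0 = Quat 0 0 0 0"

definition plus_quat :: "quat \<Rightarrow> quat \<Rightarrow> quat" where
  "p + q = Quat (qRe p + qRe q) (qIm1 p + qIm1 q) (qIm2 p + qIm2 q) (qIm3 p + qIm3 q)"

definition uminus_quat :: "quat \<Rightarrow> quat" where
  "- q = Quat (- qRe q) (- qIm1 q) (- qIm2 q) (- qIm3 q)"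

definition minus_quat :: "quat \<Rightarrow> quat \<Rightarrow> quat" where
  "p - q = Quat (qRe p - qRe q) (qIm1 p - qIm1 q) (qIm2 p - qIm2 q) (qIm3 p - qIm3 q)"

definition scaleR_quat :: "real \<Rightarrow> quat \<Rightarrow> quat" where
  "r *\<^sub>R q = Quat (r * qRe q) (r * qIm1 q) (r * qIm2 q) (r * qIm3 q)"

instance
  by standard
    (simp_all add: quat_eq_iff zero_quat_def plus_quat_def uminus_quat_def minus_quat_def
      scaleR_quat_def algebra_simps)

end

instantiation quat :: real_inner
begin

definition inner_quat :: "quat \<Rightarrow> quat \<Rightarrow> real" where
  "inner p q = qRe p * qRe q + qIm1 p * qIm1 q + qIm2 p * qIm2 q + qIm3 p * qIm3 q"

definition norm_quat :: "quat \<Rightarrow> real" where "norm (q :: quat) = sqrt (inner q q)"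

definition sgn_quat :: "quat \<Rightarrow> quat" where "sgn (q :: quat) = q /\<^sub>R norm q"

definition dist_quat :: "quat \<Rightarrow> quat \<Rightarrow> real" where "dist (p :: quat) q = norm (p - q)"

definition uniformity_quat :: "(quat \<times> quat) filter" where
  "(uniformity :: (quat \<times> quat) filter) = (INF e\<in>{0 <..}. principal {(x, y). dist x y < e})"

definition open_quat :: "quat set \<Rightarrow> bool" where
  "open (U :: quat set) \<longleftrightarrow> (\<forall>x\<in>U. eventually (\<lambda>(x', y). x' = x \<longrightarrow> y \<in> U) uniformity)"

instance
proof
  fix x :: quat
  show "0 \<le> inner x x"
    by (simp add: inner_quat_def)
  have "inner x x = 0 \<longleftrightarrow> qRe x = 0 \<and> qIm1 x = 0 \<and> qIm2 x = 0 \<and> qIm3 x = 0"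
    unfolding inner_quat_def by (smt (verit) zero_le_square mult_eq_0_iff)
  then show "inner x x = 0 \<longleftrightarrow> x = 0"
    by (simp add: quat_eq_iff zero_quat_def)
qed (simp_all add: inner_quat_def norm_quat_def sgn_quat_def dist_quat_def uniformity_quat_def
      open_quat_def plus_quat_def scaleR_quat_def algebra_simps)

end

definition qcnj :: "quat \<Rightarrow> quat" where
  "qcnj q = Quat (qRe q) (- qIm1 q) (- qIm2 q) (- qIm3 q)"

instantiation quat :: real_normed_div_algebra
begin

definition one_quat :: quat where "1 = Quat 1 0 0 0"

definition times_quat :: "quat \<Rightarrow> quat \<Rightarrow> quat" where
  "p * q = Quat
    (qRe p * qRe q - qIm1 p * qIm1 q - qIm2 p * qIm2 q - qIm3 p * qIm3 q)
    (qRe p * qIm1 q + qIm1 p * qRe q + qIm2 p * qIm3 q - qIm3 p * qIm2 q)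
    (qRe p * qIm2 q - qIm1 p * qIm3 q + qIm2 p * qRe q + qIm3 p * qIm1 q)
    (qRe p * qIm3 q + qIm1 p * qIm2 q - qIm2 p * qIm1 q + qIm3 p * qRe q)"

definition inverse_quat :: "quat \<Rightarrow> quat" where "inverse (q :: quat) = qcnj q /\<^sub>R (norm q)\<^sup>2"

definition divide_quat :: "quat \<Rightarrow> quat \<Rightarrow> quat" where "p div (q :: quat) = p * inverse q"

instance
proof
  fix a b c :: quat and r :: real
  show "a * b * c = a * (b * c)" "(a + b) * c = a * c + b * c" "a * (b + c) = a * b + a * c"
    "1 * a = a" "a * 1 = a" "r *\<^sub>R a * b = r *\<^sub>R (a * b)" "a * r *\<^sub>R b = r *\<^sub>R (a * b)"
    by (simp_all add: quat_eq_iff times_quat_def plus_quat_def one_quat_def scaleR_quat_def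
        algebra_simps)
  show "(0 :: quat) \<noteq> 1"
    by (simp add: quat_eq_iff zero_quat_def one_quat_def)
  show "a div b = a * inverse b"
    by (simp add: divide_quat_def)
  have cnj: "qcnj a * a = (norm a)\<^sup>2 *\<^sub>R 1" "a * qcnj a = (norm a)\<^sup>2 *\<^sub>R 1"
    by (simp_all add: quat_eq_iff qcnj_def times_quat_def one_quat_def scaleR_quat_def
        power2_norm_eq_inner inner_quat_def algebra_simps)
  have l: "s *\<^sub>R x * y = s *\<^sub>R (x * y)" and r: "x * s *\<^sub>R y = s *\<^sub>R (x * y)" for s and x y :: quat
    by (simp_all add: quat_eq_iff times_quat_def scaleR_quat_def algebra_simps)
  show "a \<noteq> 0 \<Longrightarrow> inverse a * a = 1"
    by (simp add: inverse_quat_def l cnj)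
  show "a \<noteq> 0 \<Longrightarrow> a * inverse a = 1"
    by (simp add: inverse_quat_def r cnj)
  show "inverse (0 :: quat) = 0"
    by (simp add: inverse_quat_def)
  have "inner (a * b) (a * b) = inner a a * inner b b"
    by (simp add: inner_quat_def times_quat_def algebra_simps)
  then show "norm (a * b) = norm a * norm b"
    by (simp add: norm_eq_sqrt_inner real_sqrt_mult)
qed

end


section \<open>Quaternionic \<open>B\<^sup>*\<close>-algebras\<close>

text \<open>
  The real vector space structure of the type class is required to be the one induced by the
  bimodule structure; that the reals act identically from both sides is then part of
  \<open>real_lact\<close> and \<open>real_ract\<close>.
\<close>

class quat_vector_space = real_vector +
  fixes lact :: "quat \<Rightarrow> 'a \<Rightarrow> 'a" (infixr "\<triangleright>" 75)
    and ract :: "'a \<Rightarrow> quat \<Rightarrow> 'a" (infixl "\<triangleleft>" 75)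
  assumes lact_add_right: "\<alpha> \<triangleright> (x + y) = \<alpha> \<triangleright> x + \<alpha> \<triangleright> y"
    and lact_add_left: "(\<alpha> + \<beta>) \<triangleright> x = \<alpha> \<triangleright> x + \<beta> \<triangleright> x"
    and lact_lact: "\<alpha> \<triangleright> (\<beta> \<triangleright> x) = (\<alpha> * \<beta>) \<triangleright> x"
    and lact_one: "1 \<triangleright> x = x"
    and ract_add_left: "(x + y) \<triangleleft> \<alpha> = x \<triangleleft> \<alpha> + y \<triangleleft> \<alpha>"
    and ract_add_right: "x \<triangleleft> (\<alpha> + \<beta>) = x \<triangleleft> \<alpha> + x \<triangleleft> \<beta>"
    and ract_ract: "(x \<triangleleft> \<alpha>) \<triangleleft> \<beta> = x \<triangleleft> (\<alpha> * \<beta>)"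
    and ract_one: "x \<triangleleft> 1 = x"
    and lact_ract: "(\<alpha> \<triangleright> x) \<triangleleft> \<beta> = \<alpha> \<triangleright> (x \<triangleleft> \<beta>)"
    and real_lact: "of_real r \<triangleright> x = r *\<^sub>R x"
    and real_ract: "x \<triangleleft> of_real r = r *\<^sub>R x"

class quat_normed_space = quat_vector_space + real_normed_vector +
  assumes norm_lact_ract_le: "norm ((\<alpha> \<triangleright> x) \<triangleleft> \<beta>) \<le> norm \<alpha> * norm x * norm \<beta>"

class quat_algebra = quat_vector_space + real_algebra +
  assumes lact_mult: "(\<gamma> \<triangleright> a) * b = \<gamma> \<triangleright> (a * b)"
    and ract_mult_lact: "(a \<triangleleft> \<gamma>) * b = a * (\<gamma> \<triangleright> b)"
    and mult_ract: "(a * b) \<triangleleft> \<gamma> = a * (b \<triangleleft> \<gamma>)"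

class quat_star_algebra = quat_algebra +
  fixes star :: "'a \<Rightarrow> 'a"
  assumes star_add: "star (a + b) = star a + star b"
    and star_scaleR: "star (r *\<^sub>R a) = r *\<^sub>R star a"
    and star_mult: "star (a * b) = star b * star a"
    and star_star: "star (star a) = a"
    and star_lact: "star (\<alpha> \<triangleright> b) = star b \<triangleleft> qcnj \<alpha>"
    and star_ract: "star (b \<triangleleft> \<alpha>) = qcnj \<alpha> \<triangleright> star b"

text \<open>Submultiplicativity of the norm is part of \<^class>\<open>real_normed_algebra\<close>; no unit is assumed.\<close>

class quat_bstar_algebra =
  quat_star_algebra + quat_normed_space + real_normed_algebra + banach +
  assumes norm_star_mult: "norm (star a * a) = (norm a)\<^sup>2"


section \<open>Hilbert bimodules\<close>

text \<open>
  Hilbert bimodules occur existentially in the representation theorem, so they are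
  carrier-based records rather than types.  Existence has to be stated over a fixed element
  type; for an algebra \<open>'a\<close> the type \<open>'a \<Rightarrow> 'a \<Rightarrow> quat\<close> is large enough for a direct sum, over
  elements of \<open>'a\<close>, of completed GNS spaces realised as functionals on \<open>'a\<close>.
\<close>

record 'h quat_bimodule =
  hcarrier :: "'h set"
  hzero :: 'h
  hadd :: "'h \<Rightarrow> 'h \<Rightarrow> 'h"
  hlact :: "quat \<Rightarrow> 'h \<Rightarrow> 'h"
  hract :: "'h \<Rightarrow> quat \<Rightarrow> 'h"
  hinner :: "'h \<Rightarrow> 'h \<Rightarrow> quat"

definition hnorm :: "'h quat_bimodule \<Rightarrow> 'h \<Rightarrow> real" where
  "hnorm Y y = sqrt (norm (hinner Y y y))"

definition hdist :: "'h quat_bimodule \<Rightarrow> 'h \<Rightarrow> 'h \<Rightarrow> real" where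
  "hdist Y x y = hnorm Y (hadd Y x (hlact Y (- 1) y))"

locale quat_carrier_vector_space =
  fixes Y :: "'h quat_bimodule"
  assumes zero_closed: "hzero Y \<in> hcarrier Y"
    and add_closed: "\<lbrakk>x \<in> hcarrier Y; y \<in> hcarrier Y\<rbrakk> \<Longrightarrow> hadd Y x y \<in> hcarrier Y"
    and lact_closed: "x \<in> hcarrier Y \<Longrightarrow> hlact Y \<alpha> x \<in> hcarrier Y"
    and ract_closed: "x \<in> hcarrier Y \<Longrightarrow> hract Y x \<alpha> \<in> hcarrier Y"
    and add_assoc: "\<lbrakk>x \<in> hcarrier Y; y \<in> hcarrier Y; z \<in> hcarrier Y\<rbrakk>
      \<Longrightarrow> hadd Y (hadd Y x y) z = hadd Y x (hadd Y y z)"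
    and add_commute: "\<lbrakk>x \<in> hcarrier Y; y \<in> hcarrier Y\<rbrakk> \<Longrightarrow> hadd Y x y = hadd Y y x"
    and add_zero: "x \<in> hcarrier Y \<Longrightarrow> hadd Y (hzero Y) x = x"
    and add_inverse: "x \<in> hcarrier Y \<Longrightarrow> \<exists>y\<in>hcarrier Y. hadd Y y x = hzero Y"
    and lact_add_right: "\<lbrakk>x \<in> hcarrier Y; y \<in> hcarrier Y\<rbrakk>
      \<Longrightarrow> hlact Y \<alpha> (hadd Y x y) = hadd Y (hlact Y \<alpha> x) (hlact Y \<alpha> y)"
    and lact_add_left: "x \<in> hcarrier Y
      \<Longrightarrow> hlact Y (\<alpha> + \<beta>) x = hadd Y (hlact Y \<alpha> x) (hlact Y \<beta> x)"
    and lact_lact: "x \<in> hcarrier Y \<Longrightarrow> hlact Y \<alpha> (hlact Y \<beta> x) = hlact Y (\<alpha> * \<beta>) x"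
    and lact_one: "x \<in> hcarrier Y \<Longrightarrow> hlact Y 1 x = x"
    and ract_add_left: "\<lbrakk>x \<in> hcarrier Y; y \<in> hcarrier Y\<rbrakk>
      \<Longrightarrow> hract Y (hadd Y x y) \<alpha> = hadd Y (hract Y x \<alpha>) (hract Y y \<alpha>)"
    and ract_add_right: "x \<in> hcarrier Y
      \<Longrightarrow> hract Y x (\<alpha> + \<beta>) = hadd Y (hract Y x \<alpha>) (hract Y x \<beta>)"
    and ract_ract: "x \<in> hcarrier Y \<Longrightarrow> hract Y (hract Y x \<alpha>) \<beta> = hract Y x (\<alpha> * \<beta>)"
    and ract_one: "x \<in> hcarrier Y \<Longrightarrow> hract Y x 1 = x"
    and lact_ract: "x \<in> hcarrier Y
      \<Longrightarrow> hract Y (hlact Y \<alpha> x) \<beta> = hlact Y \<alpha> (hract Y x \<beta>)"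
    and real_central: "x \<in> hcarrier Y \<Longrightarrow> hlact Y (of_real r) x = hract Y x (of_real r)"

locale hilbert_quat_bimodule = quat_carrier_vector_space +
  assumes inner_add_ract:
      "\<lbrakk>x \<in> hcarrier Y; y \<in> hcarrier Y; z \<in> hcarrier Y\<rbrakk>
        \<Longrightarrow> hinner Y x (hadd Y y (hract Y z \<beta>)) = hinner Y x y + hinner Y x z * \<beta>"
    and inner_commute:
      "\<lbrakk>x \<in> hcarrier Y; y \<in> hcarrier Y\<rbrakk> \<Longrightarrow> hinner Y y x = qcnj (hinner Y x y)"
    and inner_ge_zero: "x \<in> hcarrier Y \<Longrightarrow> \<exists>r\<ge>0. hinner Y x x = of_real r"
    and inner_eq_zeroD: "\<lbrakk>x \<in> hcarrier Y; hinner Y x x = 0\<rbrakk> \<Longrightarrow> x = hzero Y"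
    and inner_lact: "\<lbrakk>x \<in> hcarrier Y; y \<in> hcarrier Y\<rbrakk>
        \<Longrightarrow> hinner Y (hlact Y \<alpha> x) y = hinner Y x (hlact Y (qcnj \<alpha>) y)"
    and complete: "Metric_space.mcomplete (hcarrier Y) (hdist Y)"


section \<open>The algebra of bounded real-linear operators\<close>

text \<open>
  Operators are extensional functions on the carrier, so that equality of functions is
  equality of operators.
\<close>

definition LR_carrier :: "'h quat_bimodule \<Rightarrow> ('h \<Rightarrow> 'h) set" where
  "LR_carrier Y = {T \<in> hcarrier Y \<rightarrow>\<^sub>E hcarrier Y.
     (\<forall>x\<in>hcarrier Y. \<forall>y\<in>hcarrier Y. T (hadd Y x y) = hadd Y (T x) (T y)) \<and>
     (\<forall>r. \<forall>x\<in>hcarrier Y. T (hlact Y (of_real r) x) = hlact Y (of_real r) (T x)) \<and>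
     (\<exists>K. \<forall>x\<in>hcarrier Y. hnorm Y (T x) \<le> K * hnorm Y x)}"

definition LR_add :: "'h quat_bimodule \<Rightarrow> ('h \<Rightarrow> 'h) \<Rightarrow> ('h \<Rightarrow> 'h) \<Rightarrow> 'h \<Rightarrow> 'h" where
  "LR_add Y S T = (\<lambda>x\<in>hcarrier Y. hadd Y (S x) (T x))"

definition LR_mult :: "'h quat_bimodule \<Rightarrow> ('h \<Rightarrow> 'h) \<Rightarrow> ('h \<Rightarrow> 'h) \<Rightarrow> 'h \<Rightarrow> 'h" where
  "LR_mult Y S T = compose (hcarrier Y) S T"

definition LR_Theta :: "'h quat_bimodule \<Rightarrow> quat \<Rightarrow> 'h \<Rightarrow> 'h" where
  "LR_Theta Y \<alpha> = (\<lambda>x\<in>hcarrier Y. hlact Y \<alpha> x)"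

definition LR_lact :: "'h quat_bimodule \<Rightarrow> quat \<Rightarrow> ('h \<Rightarrow> 'h) \<Rightarrow> 'h \<Rightarrow> 'h" where
  "LR_lact Y \<alpha> T = LR_mult Y (LR_Theta Y \<alpha>) T"

definition LR_ract :: "'h quat_bimodule \<Rightarrow> ('h \<Rightarrow> 'h) \<Rightarrow> quat \<Rightarrow> 'h \<Rightarrow> 'h" where
  "LR_ract Y T \<alpha> = LR_mult Y T (LR_Theta Y \<alpha>)"

text \<open>
  The adjoint for the real inner product \<open>qRe (hinner Y x y)\<close>; it exists uniquely for
  operators in \<open>LR_carrier Y\<close> because that inner product is complete.
\<close>

definition LR_adjoint :: "'h quat_bimodule \<Rightarrow> ('h \<Rightarrow> 'h) \<Rightarrow> 'h \<Rightarrow> 'h" where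
  "LR_adjoint Y T = (THE S. S \<in> LR_carrier Y \<and>
     (\<forall>x\<in>hcarrier Y. \<forall>y\<in>hcarrier Y. qRe (hinner Y (T x) y) = qRe (hinner Y x (S y))))"

definition LR_norm :: "'h quat_bimodule \<Rightarrow> ('h \<Rightarrow> 'h) \<Rightarrow> real" where
  "LR_norm Y T = Sup {hnorm Y (T x) | x. x \<in> hcarrier Y \<and> hnorm Y x \<le> 1}"

locale quat_star_hom_LR =
  fixes Y :: "'h quat_bimodule" and \<phi> :: "'a :: quat_star_algebra \<Rightarrow> 'h \<Rightarrow> 'h"
  assumes hom_closed: "\<phi> a \<in> LR_carrier Y"
    and hom_add: "\<phi> (a + b) = LR_add Y (\<phi> a) (\<phi> b)"
    and hom_lact: "\<phi> (\<alpha> \<triangleright> a) = LR_lact Y \<alpha> (\<phi> a)"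
    and hom_ract: "\<phi> (a \<triangleleft> \<alpha>) = LR_ract Y (\<phi> a) \<alpha>"
    and hom_mult: "\<phi> (a * b) = LR_mult Y (\<phi> a) (\<phi> b)"
    and hom_star: "\<phi> (star a) = LR_adjoint Y (\<phi> a)"

end

theory Submission
  imports Defs
begin

text \<open>
  The representation is a Gelfand--Naimark--Segal construction.  Suppose that for every \<open>a\<close> there is
  a bounded real-linear functional \<open>g\<close> on the algebra, invariant under the involution, nonnegative on
  all \<open>x\<^sup>* x\<close>, and with \<open>g (a\<^sup>* a) \<ge> \<parallel>a\<parallel>\<^sup>2 / 4\<close> (\<open>quat_bstar_state_exists\<close>).  The direct sum of the
  real Hilbert spaces belonging to these functionals carries a left action of the algebra and of the
  quaternions.  Tensoring it over the reals with the quaternions adds the right action and the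
  quaternion-valued inner product, and does not change operator norms.

  The constant \<open>1/4\<close> is harmless.  It makes the operator norm \<open>N\<close> of the representation satisfy
  \<open>\<parallel>a\<parallel> \<le> 2 N(a)\<close>, and for a self-adjoint \<open>h\<close> both \<open>\<parallel>h\<parallel>\<close> and \<open>N(h)\<close> are determined by the growth of
  the norms of \<open>h\<close> raised to powers of two, so comparable norms agree
  (\<open>norm_le_equivalent_submultiplicative\<close>).

  The functionals are the heart of the matter.  In a real Banach algebra with involution the identity
  \<open>\<parallel>a\<^sup>* a\<parallel> = \<parallel>a\<parallel>\<^sup>2\<close> does not make \<open>a\<^sup>* a\<close> positive: the complex numbers with trivial involution satisfy
  it.  Quaternionic scalars exclude this.  The elements that commute with the quaternion
  unit \<open>i\<close> form a complex C*-algebra, because \<open>i\<close> acts centrally there and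
  \<open>(ib)\<^sup>* = - i b\<^sup>*\<close>.  The map \<open>b \<mapsto> (b - ibi)/2\<close> projects onto it and sends \<open>b\<^sup>* b\<close> to a sum of two elements \<open>s\<^sup>* s\<close>, so it suffices to
  find states of a complex C*-algebra.  A unit is supplied by passing to multipliers.

  In a unital complex C*-algebra, call a self-adjoint \<open>h\<close> positive if \<open>\<parallel>t - h\<parallel> \<le> t\<close> for some \<open>t \<ge> 0\<close>.
  Positive elements trivially form a cone.  An iteration for the square root, together with
  \<open>\<parallel>h\<parallel>\<^sup>2 \<le> \<parallel>h\<^sup>2 + k\<^sup>2\<parallel>\<close> for commuting self-adjoint \<open>h\<close> and \<open>k\<close>, shows that they are exactly the
  squares of self-adjoint elements and that the norm is monotone on the cone.  Kaplansky's argument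
  then gives positivity of \<open>a\<^sup>* a\<close> (\<open>cstar_pos_adj_mult_self\<close>), and the Hahn--Banach theorem, applied to
  the distance from the cone, gives the states (\<open>cstar_state_exists\<close>).
\<close>

section \<open>The Hahn--Banach theorem\<close>

definition sublinear :: "('v::real_vector \<Rightarrow> real) \<Rightarrow> bool" where
  "sublinear p \<longleftrightarrow> (\<forall>x y. p (x + y) \<le> p x + p y) \<and> (\<forall>r\<ge>0. \<forall>x. p (r *\<^sub>R x) = r * p x)"

lemma sublinear_add: "sublinear p \<Longrightarrow> p (x + y) \<le> p x + p y"
  and sublinear_scale: "sublinear p \<Longrightarrow> 0 \<le> r \<Longrightarrow> p (r *\<^sub>R x) = r * p x"
  by (auto simp: sublinear_def)

lemma sublinear_zero: "sublinear p \<Longrightarrow> p 0 = 0"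
  using sublinear_scale[of p 0 0] by simp

lemma sublinear_minus: "sublinear p \<Longrightarrow> - p (- x) \<le> p x"
  using sublinear_add[of p x "- x"] sublinear_zero[of p] by simp

text \<open>
  A sublinear \<open>p\<close> lowered as far as possible in the direction \<open>y\<close>: the result is sublinear, at most \<open>p\<close>, and
  at most \<open>- p y\<close> at \<open>- y\<close>.  A linear functional below it therefore takes the value \<open>p y\<close> at \<open>y\<close>.
\<close>

definition tilt :: "('v::real_vector \<Rightarrow> real) \<Rightarrow> 'v \<Rightarrow> 'v \<Rightarrow> real" where
  "tilt p y x = (INF t\<in>{0..}. p (x + t *\<^sub>R y) - t * p y)"

lemma tilt_le:
  assumes "sublinear p" "0 \<le> t"
  shows "tilt p y x \<le> p (x + t *\<^sub>R y) - t * p y"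
  unfolding tilt_def
proof (rule cINF_lower)
  show "bdd_below ((\<lambda>t. p (x + t *\<^sub>R y) - t * p y) ` {0..})"
  proof (rule bdd_belowI2)
    fix t :: real assume "t \<in> {0..}"
    then show "- p (- x) \<le> p (x + t *\<^sub>R y) - t * p y"
      using sublinear_add[OF assms(1), of "x + t *\<^sub>R y" "- x"] sublinear_scale[OF assms(1), of t y]
      by simp
  qed
qed (use assms in simp)

lemma le_tiltI:
  assumes "\<And>t. 0 \<le> t \<Longrightarrow> m \<le> p (x + t *\<^sub>R y) - t * p y"
  shows "m \<le> tilt p y x"
  unfolding tilt_def using assms by (intro cINF_greatest) auto

lemma sublinear_tilt:
  assumes p: "sublinear p"
  shows "sublinear (tilt p y)"
  unfolding sublinear_def
proof (intro conjI allI impI)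
  fix x z
  have "tilt p y (x + z) - (p (x + s *\<^sub>R y) - s * p y) \<le> tilt p y z" if "0 \<le> s" for s
  proof (rule le_tiltI)
    fix t :: real assume "0 \<le> t"
    have "p (x + z + (s + t) *\<^sub>R y) \<le> p (x + s *\<^sub>R y) + p (z + t *\<^sub>R y)"
      using sublinear_add[OF p, of "x + s *\<^sub>R y" "z + t *\<^sub>R y"] by (simp add: algebra_simps)
    then show "tilt p y (x + z) - (p (x + s *\<^sub>R y) - s * p y) \<le> p (z + t *\<^sub>R y) - t * p y"
      using tilt_le[OF p, of "s + t" y "x + z"] \<open>0 \<le> s\<close> \<open>0 \<le> t\<close> by (simp add: algebra_simps)
  qed
  then have "tilt p y (x + z) - tilt p y z \<le> tilt p y x"
    by (intro le_tiltI) (smt (verit))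
  then show "tilt p y (x + z) \<le> tilt p y x + tilt p y z"
    by simp
next
  have pos: "r * tilt p y x \<le> tilt p y (r *\<^sub>R x)" if "0 < r" for r x
  proof (rule le_tiltI)
    fix t :: real assume "0 \<le> t"
    then have "r * tilt p y x \<le> r * (p (x + (t / r) *\<^sub>R y) - (t / r) * p y)"
      using that by (intro mult_left_mono tilt_le p) auto
    also have "\<dots> = p (r *\<^sub>R (x + (t / r) *\<^sub>R y)) - t * p y"
      using that by (subst sublinear_scale[OF p]) (auto simp: right_diff_distrib)
    finally show "r * tilt p y x \<le> p (r *\<^sub>R x + t *\<^sub>R y) - t * p y"
      using that by (simp add: scaleR_add_right)
  qed
  fix r :: real and x assume "0 \<le> r"
  show "tilt p y (r *\<^sub>R x) = r * tilt p y x"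
  proof (cases "r = 0")
    case True
    have "tilt p y 0 \<le> 0"
      using tilt_le[OF p, of 0 y 0] sublinear_zero[OF p] by simp
    moreover have "0 \<le> tilt p y 0"
      by (rule le_tiltI) (simp add: sublinear_scale[OF p])
    ultimately show ?thesis
      using True by simp
  next
    case False
    with \<open>0 \<le> r\<close> have "0 < r" by simp
    then have "inverse r * tilt p y (r *\<^sub>R x) \<le> tilt p y x"
      using pos[of "inverse r" "r *\<^sub>R x"] by simp
    then have "tilt p y (r *\<^sub>R x) \<le> r * tilt p y x"
      using \<open>0 < r\<close> by (simp add: field_simps)
    then show ?thesis
      using pos[OF \<open>0 < r\<close>, of x] by simp
  qed
qed

text \<open>
  Zorn's lemma applies because the sublinear functionals below \<open>p\<close> are all bounded below by
  \<open>\<lambda>x. - p (- x)\<close>, so a chain has a pointwise infimum.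
\<close>

lemma minimal_sublinear_exists:
  fixes p :: "'v::real_vector \<Rightarrow> real"
  assumes p: "sublinear p"
  obtains q where "sublinear q" "q \<le> p" "\<And>r. sublinear r \<Longrightarrow> r \<le> q \<Longrightarrow> r = q"
proof -
  let ?A = "{q. sublinear q \<and> q \<le> p}"
  let ?P = "\<lambda>q r :: 'v \<Rightarrow> real. r \<le> q"
  have "\<exists>m\<in>?A. \<forall>q\<in>?A. ?P m q \<longrightarrow> q = m"
  proof (rule predicate_Zorn)
    show "partial_order_on ?A (relation_of ?P ?A)"
      by (auto simp: partial_order_on_def preorder_on_def refl_on_def trans_def antisym_def
          relation_of_def intro: order_trans)
  next
    fix C assume C: "C \<in> Chains (relation_of ?P ?A)"
    then have CA: "C \<subseteq> ?A" and lin: "\<And>q r. q \<in> C \<Longrightarrow> r \<in> C \<Longrightarrow> q \<le> r \<or> r \<le> q"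
      by (auto simp: Chains_def relation_of_def)
    show "\<exists>u\<in>?A. \<forall>q\<in>C. ?P q u"
    proof (cases "C = {}")
      case True
      then show ?thesis using p by auto
    next
      case False
      define u where "u x = (INF q\<in>C. q x)" for x
      have bdd: "bdd_below ((\<lambda>q. q x) ` C)" for x
      proof (rule bdd_belowI2)
        fix q assume "q \<in> C"
        with CA have "sublinear q" "q (- x) \<le> p (- x)" by (auto simp: le_fun_def)
        then show "- p (- x) \<le> q x" using sublinear_minus[of q x] by simp
      qed
      have u_le: "u x \<le> q x" if "q \<in> C" for q x
        unfolding u_def using bdd that by (rule cINF_lower)
      have le_u: "m \<le> u x" if "\<And>q. q \<in> C \<Longrightarrow> m \<le> q x" for m x
        unfolding u_def using False that by (rule cINF_greatest)
      have "sublinear u"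
        unfolding sublinear_def
      proof (intro conjI allI impI)
        fix x y
        have "u (x + y) - q x \<le> u y" if "q \<in> C" for q
        proof (rule le_u)
          fix r assume "r \<in> C"
          \<comment> \<open>Subadditivity of the infimum: of two members of the chain the smaller one bounds both.\<close>
          with lin that obtain s where s: "s \<in> C" "s \<le> q" "s \<le> r" by blast
          then have "u (x + y) \<le> s x + s y"
            using u_le[of s "x + y"] CA sublinear_add[of s x y] by fastforce
          then show "u (x + y) - q x \<le> r y"
            using s by (smt (verit) le_fun_def)
        qed
        then have "u (x + y) - u y \<le> u x"
          by (intro le_u) (smt (verit))
        then show "u (x + y) \<le> u x + u y" by simp
      next
        fix r :: real and x assume r: "0 \<le> r"
        have eq: "q (r *\<^sub>R x) = r * q x" if "q \<in> C" for q
          using CA that r sublinear_scale by blast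
        show "u (r *\<^sub>R x) = r * u x"
        proof (rule antisym)
          show "r * u x \<le> u (r *\<^sub>R x)"
            by (rule le_u) (simp add: eq u_le r mult_left_mono)
          show "u (r *\<^sub>R x) \<le> r * u x"
          proof (cases "r = 0")
            case True
            obtain q where "q \<in> C" using False by blast
            then show ?thesis using u_le[of q "r *\<^sub>R x"] eq[of q] True by simp
          next
            case neq: False
            have "u (r *\<^sub>R x) / r \<le> u x"
            proof (rule le_u)
              fix q assume "q \<in> C"
              then show "u (r *\<^sub>R x) / r \<le> q x"
                using u_le[of q "r *\<^sub>R x"] eq[of q] r neq by (simp add: field_simps)
            qed
            then show ?thesis using r neq by (simp add: field_simps)
          qed
        qed
      qed
      moreover have "u \<le> p"
      proof -
        obtain q where "q \<in> C" using False by blast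
        moreover from this CA have "q \<le> p" by blast
        ultimately show ?thesis using u_le[of q] by (auto simp: le_fun_def intro: order_trans)
      qed
      ultimately show ?thesis using u_le by (auto simp: le_fun_def)
    qed
  qed
  then obtain m where "m \<in> ?A" and "\<forall>q\<in>?A. ?P m q \<longrightarrow> q = m" by blast
  then show thesis using that[of m] by (auto intro: order_trans)
qed

text \<open>
  A minimal sublinear functional \<open>q\<close> equals each of its tilts, and \<open>tilt q z = q\<close> contains the inequality
  \<open>q x + q z \<le> q (x + z)\<close>; hence \<open>q\<close> is linear.  Choosing \<open>q\<close> below \<open>tilt p y\<close> fixes its value at \<open>y\<close>.
\<close>

theorem Hahn_Banach_dominated:
  fixes p :: "'v::real_vector \<Rightarrow> real"
  assumes p: "sublinear p"
  obtains f where "linear f" "\<And>x. f x \<le> p x" "f y = p y"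
proof -
  obtain q where q: "sublinear q" "q \<le> tilt p y" and min: "\<And>r. sublinear r \<Longrightarrow> r \<le> q \<Longrightarrow> r = q"
    using minimal_sublinear_exists[OF sublinear_tilt[OF p, of y]] by blast
  have q_le: "q x \<le> p x" for x
    using le_funD[OF q(2), of x] tilt_le[OF p, of 0 y x] by simp
  have tilt_q: "tilt q z = q" for z
    by (rule min) (use q(1) sublinear_tilt tilt_le[OF q(1), of 0] in \<open>auto simp: le_fun_def\<close>)
  have add: "q (x + z) = q x + q z" for x z
    using tilt_le[OF q(1), of 1 z x] sublinear_add[OF q(1), of x z] by (simp add: tilt_q)
  have neg: "q (- x) = - q x" for x
    using add[of x "- x"] sublinear_zero[OF q(1)] by simp
  have "q (r *\<^sub>R x) = r * q x" for r x
  proof (cases "0 \<le> r")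
    case True
    then show ?thesis by (rule sublinear_scale[OF q(1)])
  next
    case False
    then show ?thesis
      using sublinear_scale[OF q(1), of "- r" x] neg[of "r *\<^sub>R x"] by simp
  qed
  then have "linear q"
    by (intro linearI) (simp_all add: add)
  moreover have "q y = p y"
  proof -
    have "q (- y) \<le> - p y"
      using le_funD[OF q(2), of "- y"] tilt_le[OF p, of 1 y "- y"] sublinear_zero[OF p] by simp
    then show ?thesis using neg[of y] q_le[of y] by simp
  qed
  ultimately show thesis using that q_le by blast
qed

section \<open>Positivity and states in unital complex C*-algebras\<close>

text \<open>
  The complex scalars are encoded by one central element \<open>iunit\<close>, so that the type classes for real
  normed algebras apply unchanged.  The norm of the unit is left open, so that the zero algebra is an
  instance.
\<close>

class unital_complex_cstar = real_normed_algebra + monoid_mult + banach +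
  fixes adj :: "'a \<Rightarrow> 'a"
    and iunit :: 'a
  assumes adj_add: "adj (x + y) = adj x + adj y"
    and adj_scaleR: "adj (r *\<^sub>R x) = r *\<^sub>R adj x"
    and adj_mult: "adj (x * y) = adj y * adj x"
    and adj_adj [simp]: "adj (adj x) = x"
    and norm_adj_mult_ge: "(norm x)\<^sup>2 \<le> norm (adj x * x)"
    and iunit_central: "iunit * x = x * iunit"
    and iunit_square: "iunit * iunit = - 1"
    and adj_iunit: "adj iunit = - iunit"

lemma adj_zero [simp]: "adj (0::'a::unital_complex_cstar) = 0"
  using adj_scaleR[of 0 "0::'a"] by simp

lemma adj_minus: "adj (- x) = - adj x"
  using adj_scaleR[of "-1" x] by simp

lemma adj_diff: "adj (x - y) = adj x - adj y"
  using adj_add[of x "- y"] by (simp add: adj_minus)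

lemma adj_one [simp]: "adj (1::'a::unital_complex_cstar) = 1"
  using adj_mult[of "adj 1" "1::'a"] by simp

lemma norm_adj [simp]:
  fixes x :: "'a::unital_complex_cstar"
  shows "norm (adj x) = norm x"
proof -
  have "norm x \<le> norm (adj x)" for x :: 'a
  proof (cases "norm x = 0")
    case False
    have "norm x * norm x \<le> norm (adj x) * norm x"
      using norm_adj_mult_ge[of x] norm_mult_ineq[of "adj x" x] by (simp add: power2_eq_square)
    then show ?thesis using False by simp
  qed simp
  from this[of x] this[of "adj x"] show ?thesis by simp
qed

lemma bounded_linear_adj: "bounded_linear adj"
  by (rule bounded_linear_intro[where K = 1]) (simp_all add: adj_add adj_scaleR)

lemma norm_one_le: "norm (1 :: 'a::unital_complex_cstar) \<le> 1"
proof (rule ccontr)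
  assume "\<not> ?thesis"
  then have "norm (1 :: 'a) * 1 < norm (1 :: 'a) * norm (1 :: 'a)"
    by (intro mult_strict_left_mono) auto
  moreover have "norm (1 :: 'a) * norm (1 :: 'a) \<le> norm (1 :: 'a) * 1"
    using norm_adj_mult_ge[of "1::'a"] by (simp add: power2_eq_square)
  ultimately show False by simp
qed

lemma norm_mult_self_ge:
  assumes "adj x = x"
  shows "(norm x)\<^sup>2 \<le> norm (x * x)"
  using norm_adj_mult_ge[of x] assms by simp

lemma mult_self_eq_zeroD:
  assumes "adj x = x" "x * x = 0"
  shows "x = 0"
  using norm_mult_self_ge[OF assms(1)] assms(2) by simp

text \<open>
  The limit is \<open>w = 1 - \<surd>(1 - z)\<close>.  The iterates \<open>w' = (z + w\<^sup>2) / 2\<close> are majorised, together with their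
  differences, by the same iteration for the real number 1, which increases and is bounded by 1.  Hence
  they converge even if \<open>\<parallel>z\<parallel> = 1\<close>, and \<open>w\<close> commutes with whatever commutes with \<open>z\<close>.
\<close>

lemma square_root_iteration:
  fixes z :: "'a::unital_complex_cstar"
  assumes z: "adj z = z" "norm z \<le> 1"
  obtains w where "adj w = w" "norm w \<le> 1" "2 *\<^sub>R w = z + w * w"
    "\<And>y. y * z = z * y \<Longrightarrow> y * w = w * y"
proof -
  define f where "f w = (1/2) *\<^sub>R (z + w * w)" for w
  define w where "w n = (f ^^ n) 0" for n
  define r :: "nat \<Rightarrow> real" where "r n = ((\<lambda>r. (1 + r\<^sup>2) / 2) ^^ n) 0" for n
  have w_Suc: "w (Suc n) = (1/2) *\<^sub>R (z + w n * w n)" and w_0: "w 0 = 0" for n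
    by (simp_all add: w_def f_def)
  have r_Suc: "r (Suc n) = (1 + (r n)\<^sup>2) / 2" and r_0: "r 0 = 0" for n
    by (simp_all add: r_def)
  have w_commute: "y * w n = w n * y" if "y * z = z * y" for y n
  proof (induction n)
    case (Suc n)
    have "y * (w n * w n) = w n * w n * y"
      by (metis Suc.IH mult.assoc)
    then show ?case by (simp add: w_Suc algebra_simps that)
  qed (simp add: w_0)
  have w_sa: "adj (w n) = w n" for n
    by (induction n) (simp_all add: w_0 w_Suc adj_add adj_scaleR adj_mult z)
  have r: "0 \<le> r n \<and> r n \<le> 1" for n
  proof (induction n)
    case (Suc n)
    then have "(r n)\<^sup>2 \<le> 1" by (simp add: power_le_one)
    then show ?case by (simp add: r_Suc)
  qed (simp add: r_0)
  have norm_w: "norm (w n) \<le> r n" for n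
  proof (induction n)
    case (Suc n)
    have "norm (w n * w n) \<le> (r n)\<^sup>2"
      using norm_mult_ineq[of "w n" "w n"] mult_mono[OF Suc Suc] r[of n] by (simp add: power2_eq_square)
    then show ?case
      using norm_triangle_ineq[of z "w n * w n"] z by (simp add: w_Suc r_Suc)
  qed (simp add: w_0 r_0)
  have step: "norm (w (Suc n) - w n) \<le> r (Suc n) - r n" for n
  proof (induction n)
    case 0
    show ?case using z by (simp add: w_0 r_0 w_Suc r_Suc)
  next
    case (Suc n)
    have comm: "w n * w (Suc n) = w (Suc n) * w n"
      by (intro w_commute w_commute[symmetric]) (rule refl)
    have "w (Suc (Suc n)) - w (Suc n)
        = (1/2) *\<^sub>R (z + w (Suc n) * w (Suc n)) - (1/2) *\<^sub>R (z + w n * w n)"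
      by (rule arg_cong2[where f = minus, OF w_Suc w_Suc])
    also have "\<dots> = (1/2) *\<^sub>R ((w (Suc n) - w n) * (w (Suc n) + w n))"
      by (simp add: algebra_simps comm)
    also have "norm \<dots> \<le> (1/2) * (norm (w (Suc n) - w n) * norm (w (Suc n) + w n))"
      by (simp add: norm_mult_ineq)
    also have "\<dots> \<le> (1/2) * ((r (Suc n) - r n) * (r (Suc n) + r n))"
      using Suc order_trans[OF norm_ge_zero Suc] r[of n] r[of "Suc n"] norm_w[of n] norm_w[of "Suc n"]
      by (intro mult_left_mono mult_mono order_trans[OF norm_triangle_ineq])
         (auto intro: order_trans[OF norm_ge_zero])
    also have "\<dots> = (1 + (r (Suc n))\<^sup>2) / 2 - (1 + (r n)\<^sup>2) / 2"
      by (simp add: field_simps power2_eq_square)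
    also have "\<dots> = r (Suc (Suc n)) - r (Suc n)"
      by (simp only: r_Suc)
    finally show ?case .
  qed
  have "incseq r"
    using order_trans[OF norm_ge_zero step] by (intro incseq_SucI) simp
  with r have "convergent r"
    by (metis Bseq_mono_convergent BseqI' abs_of_nonneg real_norm_def incseq_def)
  then have "summable (\<lambda>n. r (Suc n) - r n)"
    using telescope_summable convergent_def by blast
  then have "summable (\<lambda>n. w (Suc n) - w n)"
    by (rule summable_comparison_test') (rule step)
  then have "convergent (\<lambda>n. \<Sum>i<n. w (Suc i) - w i)"
    by (simp add: summable_iff_convergent)
  then have "convergent w"
    by (simp add: sum_lessThan_telescope w_0)
  then obtain l where l: "w \<longlonglongrightarrow> l"
    by (auto simp: convergent_def)
  show thesis
  proof (rule that)
    have "(\<lambda>n. adj (w n)) \<longlonglongrightarrow> adj l"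
      using l by (rule bounded_linear.tendsto[OF bounded_linear_adj])
    then show "adj l = l"
      using LIMSEQ_unique l by (simp add: w_sa)
    show "norm l \<le> 1"
      using norm_w r by (intro LIMSEQ_le_const2[OF tendsto_norm[OF l]]) (meson order_trans)
    have "(\<lambda>n. w (Suc n)) \<longlonglongrightarrow> (1/2) *\<^sub>R (z + l * l)"
      unfolding w_Suc by (intro tendsto_intros l)
    then have "l = (1/2) *\<^sub>R (z + l * l)"
      using LIMSEQ_unique LIMSEQ_Suc[OF l] by blast
    then show "2 *\<^sub>R l = z + l * l"
      by (metis scaleR_half_double scaleR_2 scaleR_left_distrib scaleR_scaleR mult_2 scaleR_one field_sum_of_halves)
    fix y assume "y * z = z * y"
    then have "(\<lambda>n. y * w n) \<longlonglongrightarrow> l * y"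
      by (simp add: w_commute tendsto_mult_right l)
    moreover have "(\<lambda>n. y * w n) \<longlonglongrightarrow> y * l"
      by (intro tendsto_intros l)
    ultimately show "y * l = l * y"
      using LIMSEQ_unique by blast
  qed
qed

text \<open>
  The condition says that the spectrum of \<open>h\<close>, a set of real numbers, lies in the disc of radius \<open>t\<close>
  around \<open>t\<close>, that is, in \<open>[0, 2t]\<close>.  In this form it is preserved by sums for trivial reasons.
\<close>

definition cstar_pos :: "'a::unital_complex_cstar \<Rightarrow> bool" where
  "cstar_pos h \<longleftrightarrow> adj h = h \<and> (\<exists>t\<ge>0. norm (t *\<^sub>R 1 - h) \<le> t)"

lemma cstar_pos_adj: "cstar_pos h \<Longrightarrow> adj h = h"
  by (simp add: cstar_pos_def)

lemma cstar_pos_add: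
  assumes "cstar_pos h" "cstar_pos k"
  shows "cstar_pos (h + k)"
proof -
  obtain s t where "0 \<le> s" "norm (s *\<^sub>R 1 - h) \<le> s" "0 \<le> t" "norm (t *\<^sub>R 1 - k) \<le> t"
    using assms by (auto simp: cstar_pos_def)
  then have "norm ((s + t) *\<^sub>R 1 - (h + k)) \<le> s + t"
    using norm_triangle_ineq[of "s *\<^sub>R 1 - h" "t *\<^sub>R 1 - k"] by (simp add: algebra_simps)
  then show ?thesis
    using assms \<open>0 \<le> s\<close> \<open>0 \<le> t\<close> by (auto simp: cstar_pos_def adj_add intro!: exI[of _ "s + t"])
qed

lemma cstar_pos_scaleR:
  assumes "cstar_pos h" "0 \<le> r"
  shows "cstar_pos (r *\<^sub>R h)"
proof -
  obtain t where t: "0 \<le> t" "norm (t *\<^sub>R 1 - h) \<le> t"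
    using assms by (auto simp: cstar_pos_def)
  have "norm ((r * t) *\<^sub>R 1 - r *\<^sub>R h) = r * norm (t *\<^sub>R 1 - h)"
    using assms(2) by (metis abs_of_nonneg norm_scaleR scaleR_right_diff_distrib scaleR_scaleR)
  then show ?thesis
    using assms t by (auto simp: cstar_pos_def adj_scaleR mult_left_mono intro!: exI[of _ "r * t"])
qed

lemma cstar_pos_one: "0 \<le> r \<Longrightarrow> cstar_pos (r *\<^sub>R (1::'a::unital_complex_cstar))"
  by (auto simp: cstar_pos_def adj_scaleR intro!: exI[of _ r])

lemma cstar_pos_zero: "cstar_pos 0"
  by (auto simp: cstar_pos_def intro!: exI[of _ 0])

lemma cstar_pos_norm_minus:
  assumes "adj n = n"
  shows "cstar_pos (norm n *\<^sub>R 1 - n)"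
  using assms by (auto simp: cstar_pos_def adj_diff adj_scaleR intro!: exI[of _ "norm n"])

text \<open>
  This is where the complex structure enters: \<open>h\<^sup>2 + k\<^sup>2 = x\<^sup>* x\<close> for \<open>x = h + ik\<close>, and \<open>h\<close> is the self-adjoint
  part of \<open>x\<close>.
\<close>

lemma norm_square_le_norm_sum_squares:
  fixes h k :: "'a::unital_complex_cstar"
  assumes h: "adj h = h" and k: "adj k = k" and comm: "h * k = k * h"
  shows "(norm h)\<^sup>2 \<le> norm (h * h + k * k)"
proof -
  define x where "x = h + iunit * k"
  have adj_x: "adj x = h - iunit * k"
    by (simp add: x_def adj_add adj_mult adj_iunit h k iunit_central)
  have "adj x * x = h * h + h * (iunit * k) - iunit * k * h - iunit * k * (iunit * k)"
    unfolding adj_x unfolding x_def by (simp add: algebra_simps)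
  also have "h * (iunit * k) = iunit * k * h"
    by (metis comm iunit_central mult.assoc)
  also have "iunit * k * (iunit * k) = - (k * k)"
    by (metis iunit_central iunit_square mult.assoc mult_1 mult_minus_left)
  finally have eq: "adj x * x = h * h + k * k" by simp
  have "2 *\<^sub>R h = x + adj x"
    by (simp add: adj_x) (simp add: x_def scaleR_2)
  then have "2 * norm h \<le> norm x + norm (adj x)"
    by (metis norm_scaleR norm_triangle_ineq abs_numeral)
  then have "(norm h)\<^sup>2 \<le> (norm x)\<^sup>2"
    by (intro power_mono) auto
  also have "\<dots> \<le> norm (adj x * x)"
    by (rule norm_adj_mult_ge)
  finally show ?thesis by (simp add: eq)
qed

text \<open>
  With \<open>z = 1 - h/t\<close> the iteration provides \<open>(1 - w)\<^sup>2 = h/t\<close>, and \<open>\<parallel>w\<parallel> \<le> 1\<close> is exactly the positivity of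
  \<open>1 - w\<close>.
\<close>

lemma cstar_pos_sqrt:
  assumes "cstar_pos h"
  obtains k where "cstar_pos k" "k * k = h" "\<And>y. y * h = h * y \<Longrightarrow> y * k = k * y"
proof -
  obtain t where t: "0 \<le> t" "norm (t *\<^sub>R 1 - h) \<le> t" and h: "adj h = h"
    using assms by (auto simp: cstar_pos_def)
  show thesis
  proof (cases "t = 0")
    case True
    then have "h = 0" using t by simp
    then show thesis using that[of 0] by (simp add: cstar_pos_zero)
  next
    case False
    then have "0 < t" using t by simp
    define z where "z = 1 - (1 / t) *\<^sub>R h"
    have "t *\<^sub>R z = t *\<^sub>R 1 - h"
      using \<open>0 < t\<close> by (simp add: z_def scaleR_right_diff_distrib)
    then have "t * norm z \<le> t"
      using t by (metis abs_of_nonneg norm_scaleR)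
    then have "norm z \<le> 1" "adj z = z"
      using \<open>0 < t\<close> h by (simp_all add: z_def adj_diff adj_scaleR)
    then obtain w where w: "adj w = w" "norm w \<le> 1" "2 *\<^sub>R w = z + w * w"
      and comm: "\<And>y. y * z = z * y \<Longrightarrow> y * w = w * y"
      using square_root_iteration[of z] by blast
    show thesis
    proof (rule that[of "sqrt t *\<^sub>R (1 - w)"])
      show "cstar_pos (sqrt t *\<^sub>R (1 - w))"
        using w t by (intro cstar_pos_scaleR) (auto simp: cstar_pos_def adj_diff intro!: exI[of _ 1])
      have "(1 - w) * (1 - w) = 1 - 2 *\<^sub>R w + w * w"
        by (simp add: algebra_simps scaleR_2)
      also have "\<dots> = (1 / t) *\<^sub>R h"
        by (simp add: w z_def)
      finally show "sqrt t *\<^sub>R (1 - w) * sqrt t *\<^sub>R (1 - w) = h"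
        using t \<open>0 < t\<close> by simp
      fix y assume "y * h = h * y"
      then have "y * w = w * y"
        by (intro comm) (simp add: z_def algebra_simps)
      then show "y * sqrt t *\<^sub>R (1 - w) = sqrt t *\<^sub>R (1 - w) * y"
        by (simp add: algebra_simps)
    qed
  qed
qed

text \<open>
  After scaling, \<open>\<parallel>c\<parallel> \<le> 1\<close>, and the square root \<open>1 - w\<close> of \<open>1 - c\<^sup>2\<close> commutes with \<open>c\<close>.  As the squares of
  \<open>c\<close> and \<open>1 - w\<close> add up to 1, the preceding norm inequality bounds \<open>\<parallel>1 - c\<^sup>2\<parallel> = \<parallel>(1 - w)\<^sup>2\<parallel>\<close> by 1.
\<close>

lemma cstar_pos_square:
  fixes k :: "'a::unital_complex_cstar"
  assumes k: "adj k = k"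
  shows "cstar_pos (k * k)"
proof (cases "k = 0")
  case False
  define t where "t = (norm k)\<^sup>2"
  have "0 < t" using False by (simp add: t_def)
  define c where "c = (1 / norm k) *\<^sub>R k"
  have c: "adj c = c" and cc: "c * c = (1 / t) *\<^sub>R (k * k)"
    by (simp_all add: c_def adj_scaleR k t_def power2_eq_square)
  have "norm c \<le> 1" using False by (simp add: c_def)
  then have "norm (c * c) \<le> 1"
    using norm_mult_ineq[of c c] mult_mono[of "norm c" 1 "norm c" 1] by simp
  moreover have "adj (c * c) = c * c" by (simp add: adj_mult c)
  ultimately obtain w where w: "adj w = w" "2 *\<^sub>R w = c * c + w * w"
    and comm: "\<And>y. y * (c * c) = c * c * y \<Longrightarrow> y * w = w * y"
    using square_root_iteration[of "c * c"] by blast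
  have cw: "c * w = w * c"
    by (rule comm) (simp add: mult.assoc)
  have ww: "(1 - w) * (1 - w) = 1 - c * c"
    using w by (simp add: algebra_simps scaleR_2)
  have "(norm (1 - w))\<^sup>2 \<le> norm ((1 - w) * (1 - w) + c * c)"
    by (rule norm_square_le_norm_sum_squares) (simp_all add: adj_diff w c cw algebra_simps)
  also have "\<dots> \<le> 1"
    using norm_one_le by (simp add: ww)
  finally have "norm (1 - w) * norm (1 - w) \<le> 1" by (simp add: power2_eq_square)
  then have "norm (1 - c * c) \<le> 1"
    using norm_mult_ineq[of "1 - w" "1 - w"] by (simp add: ww)
  then have "cstar_pos (c * c)"
    by (auto simp: cstar_pos_def adj_mult c intro!: exI[of _ 1])
  then have "cstar_pos (t *\<^sub>R (c * c))"
    using \<open>0 < t\<close> by (intro cstar_pos_scaleR) auto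
  then show ?thesis using \<open>0 < t\<close> by (simp add: cc)
qed (simp add: cstar_pos_zero)

text \<open>
  The commuting square roots \<open>a\<close> of \<open>r + e\<close> and \<open>b\<close> of \<open>r - e\<close> satisfy \<open>e\<^sup>2 + (ab)\<^sup>2 = r\<^sup>2\<close>.
\<close>

lemma norm_le_of_cstar_pos_interval:
  fixes e :: "'a::unital_complex_cstar"
  assumes e: "adj e = e" and r: "0 \<le> r"
    and "cstar_pos (r *\<^sub>R 1 + e)" "cstar_pos (r *\<^sub>R 1 - e)"
  shows "norm e \<le> r"
proof -
  obtain a where a: "cstar_pos a" "a * a = r *\<^sub>R 1 + e"
    and comm_a: "\<And>y. y * (r *\<^sub>R 1 + e) = (r *\<^sub>R 1 + e) * y \<Longrightarrow> y * a = a * y"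
    using cstar_pos_sqrt[OF assms(3)] by metis
  obtain b where b: "cstar_pos b" "b * b = r *\<^sub>R 1 - e"
    and comm_b: "\<And>y. y * (r *\<^sub>R 1 - e) = (r *\<^sub>R 1 - e) * y \<Longrightarrow> y * b = b * y"
    using cstar_pos_sqrt[OF assms(4)] by metis
  have ea: "e * a = a * e" by (rule comm_a) (simp add: algebra_simps)
  have eb: "e * b = b * e" by (rule comm_b) (simp add: algebra_simps)
  have ab: "a * b = b * a" by (rule comm_b) (simp add: algebra_simps ea)
  have "(a * b) * (a * b) = (a * a) * (b * b)"
    by (metis ab mult.assoc)
  also have "\<dots> = (r * r) *\<^sub>R 1 - e * e"
    unfolding a(2) b(2) by (simp add: algebra_simps)
  finally have sq: "e * e + (a * b) * (a * b) = (r * r) *\<^sub>R 1"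
    by simp
  have "(norm e)\<^sup>2 \<le> norm (e * e + (a * b) * (a * b))"
  proof (rule norm_square_le_norm_sum_squares[OF e])
    show "adj (a * b) = a * b"
      using cstar_pos_adj[OF a(1)] cstar_pos_adj[OF b(1)] by (simp add: adj_mult ab)
    show "e * (a * b) = a * b * e"
      by (metis ea eb mult.assoc)
  qed
  also have "\<dots> \<le> r\<^sup>2"
    using mult_left_mono[OF norm_one_le, of "r * r"] by (simp add: sq power2_eq_square)
  finally show ?thesis using r by (rule power2_le_imp_le)
qed

text \<open>
  The element \<open>h\<close> lies between \<open>- \<parallel>h + k\<parallel>\<close> and \<open>h + k \<le> \<parallel>h + k\<parallel>\<close>.
\<close>

lemma norm_le_norm_add_cstar_pos:
  fixes h k :: "'a::unital_complex_cstar"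
  assumes "cstar_pos h" "cstar_pos k"
  shows "norm h \<le> norm (h + k)"
proof (rule norm_le_of_cstar_pos_interval)
  have "adj (h + k) = h + k" using assms by (simp add: adj_add cstar_pos_adj)
  from cstar_pos_add[OF cstar_pos_norm_minus[OF this] assms(2)]
  show "cstar_pos (norm (h + k) *\<^sub>R 1 - h)" by simp
  show "cstar_pos (norm (h + k) *\<^sub>R 1 + h)"
    by (rule cstar_pos_add[OF cstar_pos_one assms(1)]) simp
qed (use assms in \<open>auto intro: cstar_pos_adj\<close>)

lemma cstar_pos_add_eq_zeroD:
  assumes "cstar_pos h" "cstar_pos k" "h + k = 0"
  shows "h = 0"
  using norm_le_norm_add_cstar_pos[OF assms(1,2)] assms(3) by simp

text \<open>
  The identity is inherited by \<open>d = bm\<close>, for which both \<open>d\<^sup>* d = - m\<^sup>4\<close> and \<open>d d\<^sup>* = - (b b\<^sup>*)\<^sup>2\<close> are negative.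
  But \<open>d\<^sup>* d + d d\<^sup>* = 2 (x\<^sup>2 + y\<^sup>2)\<close> if \<open>d = x + iy\<close> with self-adjoint \<open>x\<close> and \<open>y\<close>.  So a sum of squares vanishes,
  and with it each of its terms.
\<close>

lemma adj_mult_self_eq_neg_square:
  fixes b m :: "'a::unital_complex_cstar"
  assumes m: "adj m = m" and b: "adj b * b = - (m * m)"
  shows "m = 0"
proof -
  define d where "d = b * m"
  define x where "x = (1/2) *\<^sub>R (d + adj d)"
  define y where "y = (1/2) *\<^sub>R (iunit * (adj d - d))"
  have x: "adj x = x" by (simp add: x_def adj_scaleR adj_add add.commute)
  have y: "adj y = y"
    by (simp add: y_def adj_scaleR adj_mult adj_iunit adj_diff iunit_central[symmetric] algebra_simps)
  have ii: "iunit * u * (iunit * v) = - (u * v)" for u v :: 'a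
    by (metis iunit_central iunit_square mult.assoc mult_1 mult_minus_left)
  have xx: "4 *\<^sub>R (x * x) = d * d + d * adj d + adj d * d + adj d * adj d"
    by (simp add: x_def algebra_simps)
  have yy: "4 *\<^sub>R (y * y) = d * adj d + adj d * d - d * d - adj d * adj d"
    by (simp add: y_def ii) (simp add: algebra_simps)
  have sum: "2 *\<^sub>R (x * x + y * y) = d * adj d + adj d * d"
  proof -
    have "4 *\<^sub>R (x * x + y * y) = 2 *\<^sub>R (d * adj d + adj d * d)"
      unfolding scaleR_add_right xx yy by (simp add: scaleR_2)
    from arg_cong[OF this, of "scaleR (1/2)"] show ?thesis by simp
  qed
  have "adj d * d = m * (adj b * b) * m"
    by (simp add: d_def adj_mult m mult.assoc)
  then have 1: "adj d * d = - ((m * m) * (m * m))"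
    by (simp add: b mult.assoc)
  have "(b * adj b) * (b * adj b) = b * (adj b * b) * adj b"
    by (simp only: mult.assoc)
  then have 2: "d * adj d = - ((b * adj b) * (b * adj b))"
    by (simp add: b d_def adj_mult m mult.assoc)
  have "(m * m) * (m * m) + ((b * adj b) * (b * adj b) + 2 *\<^sub>R (x * x + y * y)) = 0"
    by (simp add: sum 1 2)
  then have "(m * m) * (m * m) = 0"
    by (rule cstar_pos_add_eq_zeroD[rotated 2])
       (auto intro!: cstar_pos_add cstar_pos_scaleR cstar_pos_square simp: adj_mult m x y)
  then show ?thesis
    by (intro mult_self_eq_zeroD[OF m] mult_self_eq_zeroD[of "m * m"]) (simp_all add: adj_mult m)
qed

text \<open>
  Let \<open>h = a\<^sup>* a\<close> and \<open>q = |h|\<close>, the square root of \<open>h\<^sup>2\<close>; then \<open>v = q - h\<close> is twice the negative part of \<open>h\<close>.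
  From \<open>vh = - vq\<close> one gets \<open>(av)\<^sup>* (av) = vhv = - (v \<surd>q)\<^sup>2\<close>, so \<open>v \<surd>q = 0\<close> by the previous lemma.  This forces
  \<open>v = 0\<close>, and \<open>h = q\<close> is positive.
\<close>

theorem cstar_pos_adj_mult_self:
  fixes a :: "'a::unital_complex_cstar"
  shows "cstar_pos (adj a * a)"
proof -
  define h where "h = adj a * a"
  have h: "adj h = h" by (simp add: h_def adj_mult)
  obtain q where q: "cstar_pos q" "q * q = h * h"
    and comm_q: "\<And>y. y * (h * h) = h * h * y \<Longrightarrow> y * q = q * y"
    using cstar_pos_sqrt[OF cstar_pos_square[OF h]] by metis
  have hq: "h * q = q * h" by (rule comm_q) (simp add: mult.assoc)
  obtain s where s: "cstar_pos s" "s * s = q"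
    and comm_s: "\<And>y. y * q = q * y \<Longrightarrow> y * s = s * y"
    using cstar_pos_sqrt[OF q(1)] by metis
  have hs: "h * s = s * h" by (rule comm_s[OF hq])
  have qs: "q * s = s * q" using s(2) by (metis mult.assoc)
  define v where "v = q - h"
  have v: "adj v = v" by (simp add: v_def adj_diff h cstar_pos_adj[OF q(1)])
  have vs: "v * s = s * v" by (simp add: v_def algebra_simps hs qs)
  have vh: "v * h = - (v * q)"
    by (simp add: v_def algebra_simps q hq)
  have "adj (a * v) * (a * v) = v * h * v"
    by (simp add: adj_mult v h_def mult.assoc)
  also have "\<dots> = - (v * (s * s) * v)"
    by (simp add: vh s)
  also have "v * (s * s) * v = (v * s) * (v * s)"
    by (metis vs mult.assoc)
  finally have "v * s = 0"
    by (intro adj_mult_self_eq_neg_square[of "v * s" "a * v"])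
       (simp_all add: adj_mult v cstar_pos_adj[OF s(1)] vs)
  then have vq: "v * q = 0"
    using s(2) by (metis mult.assoc mult_zero_left)
  have "v * v = v * q - v * h" by (simp add: v_def algebra_simps)
  also have "\<dots> = 0" by (simp add: vh vq)
  finally have "v = 0" by (rule mult_self_eq_zeroD[OF v])
  then show ?thesis using q(1) by (simp add: v_def h_def)
qed

text \<open>
  The functional \<open>p x\<close> is the distance from \<open>- x\<close> to the positive cone.  A linear \<open>f \<le> p\<close> is nonnegative on
  the cone, since \<open>p (- k) \<le> 0\<close> for positive \<open>k\<close>, and \<open>p m = \<parallel>m\<parallel>\<close> for positive \<open>m\<close>, since the norm is monotone on
  the cone.
\<close>

theorem cstar_state_exists:
  fixes m :: "'a::unital_complex_cstar"
  assumes m: "cstar_pos m"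
  obtains f :: "'a \<Rightarrow> real" where "linear f" "\<And>x. f (adj x) = f x" "\<And>x. cstar_pos x \<Longrightarrow> 0 \<le> f x"
    "\<And>x. \<bar>f x\<bar> \<le> norm x" "f m = norm m"
proof -
  define p where "p x = (INF k\<in>Collect cstar_pos. norm (x + k))" for x :: 'a
  have p_le: "p x \<le> norm (x + k)" if "cstar_pos k" for x k
    unfolding p_def using that by (intro cINF_lower bdd_belowI2[where m = 0]) auto
  have le_p: "r \<le> p x" if "\<And>k. cstar_pos k \<Longrightarrow> r \<le> norm (x + k)" for r x
    unfolding p_def using that cstar_pos_zero by (intro cINF_greatest) auto
  have scale_le: "r * p x \<le> p (r *\<^sub>R x)" if "0 < r" for r x
  proof (rule le_p)
    fix k :: 'a assume "cstar_pos k"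
    then have "r * p x \<le> r * norm (x + inverse r *\<^sub>R k)"
      using that by (intro mult_left_mono p_le cstar_pos_scaleR) auto
    also have "\<dots> = norm (r *\<^sub>R (x + inverse r *\<^sub>R k))" using that by simp
    finally show "r * p x \<le> norm (r *\<^sub>R x + k)" using that by (simp add: scaleR_add_right)
  qed
  have "sublinear p"
    unfolding sublinear_def
  proof (intro conjI allI impI)
    fix x y
    have "p (x + y) - norm (x + k) \<le> p y" if k: "cstar_pos k" for k
    proof (rule le_p)
      fix l :: 'a assume "cstar_pos l"
      then show "p (x + y) - norm (x + k) \<le> norm (y + l)"
        using p_le[OF cstar_pos_add[OF k], of l "x + y"] norm_triangle_ineq[of "x + k" "y + l"]
        by (simp add: algebra_simps)
    qed
    then have "p (x + y) - p y \<le> p x" by (intro le_p) (smt (verit))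
    then show "p (x + y) \<le> p x + p y" by simp
  next
    fix r :: real and x assume "0 \<le> r"
    show "p (r *\<^sub>R x) = r * p x"
    proof (cases "r = 0")
      case True
      then show ?thesis
        using p_le[OF cstar_pos_zero, of 0] le_p[of 0 0] by simp
    next
      case False
      with \<open>0 \<le> r\<close> have "0 < r" by simp
      then have "inverse r * p (r *\<^sub>R x) \<le> p x"
        using scale_le[of "inverse r" "r *\<^sub>R x"] by simp
      then have "p (r *\<^sub>R x) \<le> r * p x" using \<open>0 < r\<close> by (simp add: field_simps)
      then show ?thesis using scale_le[OF \<open>0 < r\<close>, of x] by simp
    qed
  qed
  then obtain f where f: "linear f" "\<And>x. f x \<le> p x" "f m = p m"
    using Hahn_Banach_dominated[of p m] by blast
  have f_le: "f x \<le> norm x" for x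
    using f(2)[of x] p_le[OF cstar_pos_zero, of x] by simp
  have f_abs: "\<bar>f x\<bar> \<le> norm x" for x
    using f_le[of x] f_le[of "- x"] linear_neg[OF f(1), of x] by simp
  have f_pos: "0 \<le> f k" if "cstar_pos k" for k
    using f(2)[of "- k"] p_le[OF that, of "- k"] linear_neg[OF f(1), of k] by simp
  have f_m: "f m = norm m"
    using le_p[of "norm m" m] norm_le_norm_add_cstar_pos[OF m] f(3) f_le[of m] by simp
  \<comment> \<open>Averaging over the involution makes the functional symmetric and keeps its values on self-adjoint elements.\<close>
  show thesis
  proof (rule that[of "\<lambda>x. (f x + f (adj x)) / 2"])
    show "linear (\<lambda>x. (f x + f (adj x)) / 2)"
      by (rule linearI)
         (simp_all add: adj_add adj_scaleR linear_add[OF f(1)] linear_cmul[OF f(1)] field_simps)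
    show "\<bar>(f x + f (adj x)) / 2\<bar> \<le> norm x" for x
      using f_abs[of x] f_abs[of "adj x"] by (simp add: abs_le_iff)
  qed (use f_pos f_m cstar_pos_adj[OF m] in \<open>simp_all add: cstar_pos_adj add.commute\<close>)
qed

section \<open>Quaternions and scalar multiplications\<close>

definition qi :: quat where "qi = Quat 0 1 0 0"
definition qj :: quat where "qj = Quat 0 0 1 0"

lemma qi_qi: "qi * qi = - 1" and qj_qj: "qj * qj = - 1" and qi_qj: "qi * qj = - (qj * qi)"
  by (simp_all add: qi_def qj_def quat_eq_iff times_quat_def uminus_quat_def one_quat_def)

lemma qcnj_qi: "qcnj qi = - qi" and qcnj_qj: "qcnj qj = - qj"
  by (simp_all add: qi_def qj_def quat_eq_iff qcnj_def uminus_quat_def)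

lemma norm_qi: "norm qi = 1" and norm_qj: "norm qj = 1"
  by (simp_all add: qi_def qj_def norm_quat_def inner_quat_def)

lemma qcnj_qcnj [simp]: "qcnj (qcnj \<alpha>) = \<alpha>"
  by (simp add: qcnj_def)

lemma qcnj_mult: "qcnj (\<alpha> * \<beta>) = qcnj \<beta> * qcnj \<alpha>"
  by (simp add: qcnj_def quat_eq_iff times_quat_def)

lemma qcnj_mult_self: "qcnj \<alpha> * \<alpha> = of_real ((norm \<alpha>)\<^sup>2)"
  by (simp add: of_real_def quat_eq_iff qcnj_def times_quat_def one_quat_def scaleR_quat_def
        power2_norm_eq_inner inner_quat_def algebra_simps)

lemma norm_qcnj: "norm (qcnj \<alpha>) = norm \<alpha>"
  by (simp add: qcnj_def norm_quat_def inner_quat_def)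

lemma lact_scaleR: "\<alpha> \<triangleright> (r *\<^sub>R x) = r *\<^sub>R (\<alpha> \<triangleright> x)"
proof -
  have "\<alpha> \<triangleright> (of_real r \<triangleright> x) = of_real r \<triangleright> (\<alpha> \<triangleright> x)"
    by (simp add: lact_lact of_real_def)
  then show ?thesis by (simp only: real_lact)
qed

lemma ract_scaleR: "(r *\<^sub>R x) \<triangleleft> \<alpha> = r *\<^sub>R (x \<triangleleft> \<alpha>)"
proof -
  have "(x \<triangleleft> of_real r) \<triangleleft> \<alpha> = (x \<triangleleft> \<alpha>) \<triangleleft> of_real r"
    by (simp add: ract_ract of_real_def)
  then show ?thesis by (simp only: real_ract)
qed

lemma lact_minus_one: "(- 1) \<triangleright> x = - x"
  using real_lact[of "-1" x] by simp

lemma ract_minus_one: "x \<triangleleft> (- 1) = - x"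
  using real_ract[of x "-1"] by simp

lemma lact_minus_left: "(- \<alpha>) \<triangleright> x = - (\<alpha> \<triangleright> x)"
  using lact_lact[of "-1" \<alpha> x] by (simp add: lact_minus_one)

lemma ract_minus_right: "x \<triangleleft> (- \<alpha>) = - (x \<triangleleft> \<alpha>)"
  using ract_ract[of x \<alpha> "-1"] by (simp add: ract_minus_one)

lemma lact_minus_right: "\<alpha> \<triangleright> (- x) = - (\<alpha> \<triangleright> x)"
  using lact_scaleR[of \<alpha> "-1" x] by simp

lemma ract_minus_left: "(- x) \<triangleleft> \<alpha> = - (x \<triangleleft> \<alpha>)"
  using ract_scaleR[of "-1" x \<alpha>] by simp

lemma lact_diff_right: "\<alpha> \<triangleright> (x - y) = \<alpha> \<triangleright> x - \<alpha> \<triangleright> y"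
  using lact_add_right[of \<alpha> x "- y"] by (simp add: lact_minus_right)

lemma ract_diff_left: "(x - y) \<triangleleft> \<alpha> = x \<triangleleft> \<alpha> - y \<triangleleft> \<alpha>"
  using ract_add_left[of x "- y" \<alpha>] by (simp add: ract_minus_left)

lemma lact_zero_right: "\<alpha> \<triangleright> 0 = 0"
  using lact_diff_right[of \<alpha> 0 0] by simp

lemma norm_lact: "norm (\<alpha> \<triangleright> x) = norm \<alpha> * norm (x :: 'a::quat_normed_space)"
proof (rule antisym)
  have le: "norm (\<alpha> \<triangleright> x) \<le> norm \<alpha> * norm x" for \<alpha> and x :: 'a
    using norm_lact_ract_le[of \<alpha> x 1] by (simp add: ract_one)
  show "norm (\<alpha> \<triangleright> x) \<le> norm \<alpha> * norm x" by (rule le)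
  show "norm \<alpha> * norm x \<le> norm (\<alpha> \<triangleright> x)"
  proof (cases "\<alpha> = 0")
    case False
    have "norm x \<le> inverse (norm \<alpha>) * norm (\<alpha> \<triangleright> x)"
      using le[of "inverse \<alpha>" "\<alpha> \<triangleright> x"] False by (simp add: lact_lact lact_one norm_inverse)
    then show ?thesis using False by (simp add: field_simps)
  qed simp
qed

lemma bounded_linear_lact: "bounded_linear (\<lambda>x :: 'a::quat_normed_space. \<alpha> \<triangleright> x)"
  by (rule bounded_linear_intro[where K = "norm \<alpha>"])
     (simp_all add: lact_add_right lact_scaleR norm_lact mult.commute)

lemma norm_star: "norm (star x) = norm (x :: 'a::quat_bstar_algebra)"
proof -
  have "norm x \<le> norm (star x)" for x :: 'a
  proof (cases "norm x = 0")
    case False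
    have "norm x * norm x \<le> norm (star x) * norm x"
      using norm_star_mult[of x] norm_mult_ineq[of "star x" x] by (simp add: power2_eq_square)
    then show ?thesis using False by simp
  qed simp
  from this[of x] this[of "star x"] show ?thesis by (simp add: star_star)
qed

lemma bounded_linear_star: "bounded_linear (star :: 'a::quat_bstar_algebra \<Rightarrow> 'a)"
  by (rule bounded_linear_intro[where K = 1]) (simp_all add: star_add star_scaleR norm_star)

lemma star_minus: "star (- x) = - star (x :: 'a::quat_star_algebra)"
  using star_scaleR[of "-1" x] by simp

lemma star_diff: "star (x - y) = star x - star (y :: 'a::quat_star_algebra)"
  using star_add[of x "- y"] by (simp add: star_minus)

lemma star_zero: "star 0 = (0 :: 'a::quat_star_algebra)"
  using star_diff[of 0 0] by simp

text \<open>
  Taking \<open>x = u - v\<close> is enough, by the norm identity.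
\<close>

lemma star_mult_nondegenerate:
  fixes u v :: "'a::quat_bstar_algebra"
  assumes "\<And>x. star x * u = star x * v"
  shows "u = v"
  using norm_star_mult[of "u - v"] assms[of "u - v"] by (simp add: right_diff_distrib)

section \<open>The multipliers that commute with the quaternion unit i\<close>

text \<open>
  The operator \<open>S\<close> is an adjoint of \<open>T\<close> for the algebra-valued form \<open>x\<^sup>* y\<close>.  Commuting with left multiplication
  by the unit \<open>i\<close> is what makes that multiplication central among the operators considered.
\<close>

definition adjoint_pair :: "('a::quat_bstar_algebra \<Rightarrow>\<^sub>L 'a) \<Rightarrow> ('a \<Rightarrow>\<^sub>L 'a) \<Rightarrow> bool" where
  "adjoint_pair T S \<longleftrightarrow>
    (\<forall>x y. star (blinfun_apply T x) * y = star x * blinfun_apply S y) \<and>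
    (\<forall>x. blinfun_apply T (qi \<triangleright> x) = qi \<triangleright> blinfun_apply T x) \<and>
    (\<forall>x. blinfun_apply S (qi \<triangleright> x) = qi \<triangleright> blinfun_apply S x)"

lemma adjoint_pairD: "adjoint_pair T S \<Longrightarrow> star (blinfun_apply T x) * y = star x * blinfun_apply S y"
  by (simp add: adjoint_pair_def)

lemma adjoint_pair_sym:
  assumes "adjoint_pair T S"
  shows "adjoint_pair S T"
proof -
  have "star (blinfun_apply S x) * y = star x * blinfun_apply T y" for x y
    using arg_cong[OF adjoint_pairD[OF assms, of y x], of star] by (simp add: star_mult star_star)
  then show ?thesis using assms by (simp add: adjoint_pair_def)
qed

lemma adjoint_pair_unique:
  assumes "adjoint_pair T S" "adjoint_pair T S'"
  shows "S = S'"
proof (rule blinfun_eqI)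
  fix y
  show "blinfun_apply S y = blinfun_apply S' y"
    by (rule star_mult_nondegenerate) (metis assms adjoint_pairD)
qed

text \<open>
  As for operators on a Hilbert space, \<open>\<parallel>Tx\<parallel>\<^sup>2 = \<parallel>(Tx)\<^sup>* Tx\<parallel> = \<parallel>x\<^sup>* STx\<parallel>\<close>.
\<close>

lemma adjoint_pair_norm_le:
  assumes "adjoint_pair T S"
  shows "(norm T)\<^sup>2 \<le> norm (S o\<^sub>L T)"
proof -
  have "norm T \<le> sqrt (norm (S o\<^sub>L T))"
  proof (rule norm_blinfun_bound)
    fix x
    have "(norm (blinfun_apply T x))\<^sup>2 = norm (star x * blinfun_apply (S o\<^sub>L T) x)"
      by (simp flip: norm_star_mult add: adjoint_pairD[OF assms])
    also have "\<dots> \<le> norm x * (norm (S o\<^sub>L T) * norm x)"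
      by (intro order_trans[OF norm_mult_ineq] mult_mono norm_blinfun) (auto simp: norm_star)
    also have "\<dots> = (sqrt (norm (S o\<^sub>L T)) * norm x)\<^sup>2"
      by (simp add: power_mult_distrib) (simp add: power2_eq_square)
    finally show "norm (blinfun_apply T x) \<le> sqrt (norm (S o\<^sub>L T)) * norm x"
      by (rule power2_le_imp_le) simp
  qed simp
  then have "(norm T)\<^sup>2 \<le> (sqrt (norm (S o\<^sub>L T)))\<^sup>2" by (intro power_mono) auto
  then show ?thesis by simp
qed

lemma adjoint_pair_norm_eq:
  assumes "adjoint_pair T S"
  shows "norm S = norm T"
proof -
  have le: "norm T \<le> norm S" if "adjoint_pair T S" for T S :: "'a \<Rightarrow>\<^sub>L 'a"
  proof (cases "norm T = 0")
    case False
    have "norm T * norm T \<le> norm S * norm T"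
      using adjoint_pair_norm_le[OF that] norm_blinfun_compose[of S T] by (simp add: power2_eq_square)
    then show ?thesis using False by simp
  qed simp
  show ?thesis
    using le[OF assms] le[OF adjoint_pair_sym[OF assms]] by simp
qed

lemma adjoint_pair_zero: "adjoint_pair 0 0"
  by (simp add: adjoint_pair_def star_zero lact_zero_right)

lemma adjoint_pair_id: "adjoint_pair id_blinfun id_blinfun"
  by (simp add: adjoint_pair_def)

lemma adjoint_pair_add:
  "adjoint_pair T S \<Longrightarrow> adjoint_pair T' S' \<Longrightarrow> adjoint_pair (T + T') (S + S')"
  by (simp add: adjoint_pair_def plus_blinfun.rep_eq star_add lact_add_right algebra_simps)

lemma adjoint_pair_scaleR: "adjoint_pair T S \<Longrightarrow> adjoint_pair (r *\<^sub>R T) (r *\<^sub>R S)"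
  by (simp add: adjoint_pair_def scaleR_blinfun.rep_eq star_scaleR lact_scaleR)

lemma adjoint_pair_compose:
  "adjoint_pair T S \<Longrightarrow> adjoint_pair T' S' \<Longrightarrow> adjoint_pair (T o\<^sub>L T') (S' o\<^sub>L S)"
  by (simp add: adjoint_pair_def)

lemma adjoint_pair_qi:
  "adjoint_pair (Blinfun (\<lambda>x :: 'a::quat_bstar_algebra. qi \<triangleright> x)) (- Blinfun (\<lambda>x. qi \<triangleright> x))"
  by (simp add: adjoint_pair_def bounded_linear_Blinfun_apply bounded_linear_lact
      uminus_blinfun.rep_eq star_lact qcnj_qi ract_minus_right ract_mult_lact lact_minus_right)

lemma adjoint_pair_diff: "adjoint_pair T S \<Longrightarrow> adjoint_pair T' S' \<Longrightarrow> adjoint_pair (T - T') (S - S')"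
  using adjoint_pair_add[OF _ adjoint_pair_scaleR, of T S T' S' "-1"] by simp

text \<open>
  A unital complex C*-algebra that contains the elements commuting with \<open>i\<close>, acting by left
  multiplication.
\<close>

typedef (overloaded) 'a::quat_bstar_algebra multiplier =
  "{T :: 'a \<Rightarrow>\<^sub>L 'a. \<exists>S. adjoint_pair T S}"
  using adjoint_pair_id by blast

setup_lifting type_definition_multiplier

instantiation multiplier :: (quat_bstar_algebra) real_vector
begin

lift_definition zero_multiplier :: "'a multiplier" is 0
  using adjoint_pair_zero by blast
lift_definition plus_multiplier :: "'a multiplier \<Rightarrow> 'a multiplier \<Rightarrow> 'a multiplier" is "(+)"
  using adjoint_pair_add by blast
lift_definition minus_multiplier :: "'a multiplier \<Rightarrow> 'a multiplier \<Rightarrow> 'a multiplier" is "(-)"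
  using adjoint_pair_diff by blast
lift_definition uminus_multiplier :: "'a multiplier \<Rightarrow> 'a multiplier" is uminus
  using adjoint_pair_scaleR[of _ _ "-1"] by (metis scaleR_minus1_left)
lift_definition scaleR_multiplier :: "real \<Rightarrow> 'a multiplier \<Rightarrow> 'a multiplier" is scaleR
  using adjoint_pair_scaleR by blast
instance
proof
  fix x y z :: "'a multiplier" and r s :: real
  show "x + y + z = x + (y + z)" "x + y = y + x" "0 + x = x" "- x + x = 0" "x - y = x + - y"
    "r *\<^sub>R (x + y) = r *\<^sub>R x + r *\<^sub>R y" "(r + s) *\<^sub>R x = r *\<^sub>R x + s *\<^sub>R x"
    "r *\<^sub>R s *\<^sub>R x = (r * s) *\<^sub>R x" "1 *\<^sub>R x = x"
    by (transfer; simp add: algebra_simps)+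
qed

end

instantiation multiplier :: (quat_bstar_algebra) real_normed_algebra
begin

lift_definition times_multiplier :: "'a multiplier \<Rightarrow> 'a multiplier \<Rightarrow> 'a multiplier" is "(o\<^sub>L)"
  using adjoint_pair_compose by blast
lift_definition norm_multiplier :: "'a multiplier \<Rightarrow> real" is norm .

definition dist_multiplier :: "'a multiplier \<Rightarrow> 'a multiplier \<Rightarrow> real" where
  "dist_multiplier x y = norm (x - y)"
definition sgn_multiplier :: "'a multiplier \<Rightarrow> 'a multiplier" where
  "sgn_multiplier x = x /\<^sub>R norm x"
definition uniformity_multiplier :: "('a multiplier \<times> 'a multiplier) filter" where
  "uniformity_multiplier = (INF e\<in>{0 <..}. principal {(x, y). dist x y < e})"
definition open_multiplier :: "'a multiplier set \<Rightarrow> bool" where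
  "open_multiplier U \<longleftrightarrow> (\<forall>x\<in>U. eventually (\<lambda>(x', y). x' = x \<longrightarrow> y \<in> U) uniformity)"

instance
proof
  fix x y z :: "'a multiplier" and r s :: real
  show "x * y * z = x * (y * z)" "(x + y) * z = x * z + y * z" "x * (y + z) = x * y + x * z"
    "r *\<^sub>R x * y = r *\<^sub>R (x * y)" "x * r *\<^sub>R y = r *\<^sub>R (x * y)"
    by (transfer; rule blinfun_eqI; simp add: blinfun.bilinear_simps)+
  show "norm x = 0 \<longleftrightarrow> x = 0" "norm (x + y) \<le> norm x + norm y" "norm (r *\<^sub>R x) = \<bar>r\<bar> * norm x"
    by (transfer; simp add: norm_triangle_ineq)+
  show "norm (x * y) \<le> norm x * norm y"
    by transfer (rule norm_blinfun_compose)
qed (simp_all add: dist_multiplier_def sgn_multiplier_def uniformity_multiplier_def open_multiplier_def)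

end

instantiation multiplier :: (quat_bstar_algebra) unital_complex_cstar
begin

lift_definition one_multiplier :: "'a multiplier" is id_blinfun
  using adjoint_pair_id by blast
lift_definition iunit_multiplier :: "'a multiplier" is "Blinfun (\<lambda>x. qi \<triangleright> x)"
  using adjoint_pair_qi by blast
lift_definition adj_multiplier :: "'a multiplier \<Rightarrow> 'a multiplier" is "\<lambda>T. THE S. adjoint_pair T S"
  by (metis adjoint_pair_unique adjoint_pair_sym theI)

lemma adjoint_pair_adj: "adjoint_pair (Rep_multiplier x) (Rep_multiplier (adj x))"
  by transfer (metis adjoint_pair_unique theI)

lemma adj_eqI:
  assumes "adjoint_pair (Rep_multiplier x) (Rep_multiplier y)"
  shows "adj x = y"
  using adjoint_pair_unique[OF adjoint_pair_adj assms] by (simp add: Rep_multiplier_inject)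

instance
proof
  fix x y :: "'a multiplier" and r :: real
  note a = adjoint_pair_adj
  show "1 * x = x" "x * 1 = x"
    by (transfer; rule blinfun_eqI; simp)+
  show "adj (x + y) = adj x + adj y"
    by (rule adj_eqI) (simp add: plus_multiplier.rep_eq adjoint_pair_add a)
  show "adj (r *\<^sub>R x) = r *\<^sub>R adj x"
    by (rule adj_eqI) (simp add: scaleR_multiplier.rep_eq adjoint_pair_scaleR a)
  show "adj (x * y) = adj y * adj x"
    by (rule adj_eqI) (simp add: times_multiplier.rep_eq adjoint_pair_compose a)
  show "adj (adj x) = x"
    by (rule adj_eqI) (rule adjoint_pair_sym[OF a])
  show "(norm x)\<^sup>2 \<le> norm (adj x * x)"
    using adjoint_pair_norm_le[OF a[of x]] by (simp add: norm_multiplier.rep_eq times_multiplier.rep_eq)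
  show "iunit * x = x * iunit"
    by transfer (rule blinfun_eqI, auto simp: adjoint_pair_def bounded_linear_Blinfun_apply bounded_linear_lact)
  show "iunit * iunit = (- 1 :: 'a multiplier)"
    by transfer (rule blinfun_eqI, simp add: bounded_linear_Blinfun_apply bounded_linear_lact
        lact_lact qi_qi lact_minus_one uminus_blinfun.rep_eq)
  show "adj iunit = (- iunit :: 'a multiplier)"
    by (rule adj_eqI) (simp add: iunit_multiplier.rep_eq uminus_multiplier.rep_eq adjoint_pair_qi)
  fix X :: "nat \<Rightarrow> 'a multiplier" assume X: "Cauchy X"
  \<comment> \<open>The adjoints form a Cauchy sequence too, so operators and adjoints converge together.\<close>
  define T where "T n = Rep_multiplier (X n)" for n
  define S where "S n = Rep_multiplier (adj (X n))" for n
  have TS: "adjoint_pair (T n) (S n)" for n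
    unfolding T_def S_def by (rule a)
  have "dist (S m) (S n) = dist (X m) (X n)" "dist (T m) (T n) = dist (X m) (X n)" for m n
    using adjoint_pair_norm_eq[OF adjoint_pair_diff[OF TS TS], of m n]
    by (simp_all add: dist_norm T_def norm_multiplier.rep_eq minus_multiplier.rep_eq)
  with X have "Cauchy T" "Cauchy S"
    by (simp_all add: Cauchy_def)
  then obtain A B where A: "T \<longlonglongrightarrow> A" and B: "S \<longlonglongrightarrow> B"
    by (meson Cauchy_convergent convergent_def)
  have TA: "(\<lambda>n. blinfun_apply (T n) x) \<longlonglongrightarrow> blinfun_apply A x"
    and SB: "(\<lambda>n. blinfun_apply (S n) x) \<longlonglongrightarrow> blinfun_apply B x" for x
    using A B by (auto intro!: tendsto_intros)
  have "star (blinfun_apply A x) * y = star x * blinfun_apply B y" for x y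
  proof (rule LIMSEQ_unique)
    show "(\<lambda>n. star (blinfun_apply (T n) x) * y) \<longlonglongrightarrow> star (blinfun_apply A x) * y"
      by (intro tendsto_intros bounded_linear.tendsto[OF bounded_linear_star] TA)
    show "(\<lambda>n. star (blinfun_apply (T n) x) * y) \<longlonglongrightarrow> star x * blinfun_apply B y"
      unfolding adjoint_pairD[OF TS] by (intro tendsto_intros SB)
  qed
  moreover have "blinfun_apply A (qi \<triangleright> x) = qi \<triangleright> blinfun_apply A x" for x
    using LIMSEQ_unique[OF TA[of "qi \<triangleright> x"]] bounded_linear.tendsto[OF bounded_linear_lact TA, of qi x] TS
    by (simp add: adjoint_pair_def)
  moreover have "blinfun_apply B (qi \<triangleright> x) = qi \<triangleright> blinfun_apply B x" for x
    using LIMSEQ_unique[OF SB[of "qi \<triangleright> x"]] bounded_linear.tendsto[OF bounded_linear_lact SB, of qi x] TS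
    by (simp add: adjoint_pair_def)
  ultimately have "adjoint_pair A B"
    by (simp add: adjoint_pair_def)
  then have "Rep_multiplier (Abs_multiplier A) = A"
    by (intro Abs_multiplier_inverse) blast
  then have "dist (X n) (Abs_multiplier A) = dist (T n) A" for n
    by (simp add: dist_norm T_def norm_multiplier.rep_eq minus_multiplier.rep_eq)
  then have "X \<longlonglongrightarrow> Abs_multiplier A"
    using A by (subst tendsto_dist_iff) (simp add: tendsto_dist_iff[of T])
  then show "convergent X"
    by (auto simp: convergent_def)
qed

end

section \<open>States of a quaternionic B*-algebra\<close>

text \<open>
  The projection onto the elements that commute with \<open>i\<close>, along those that anticommute with \<open>i\<close>.
\<close>

definition qi_commuting_part :: "'a::quat_vector_space \<Rightarrow> 'a" where
  "qi_commuting_part y = (1/2) *\<^sub>R (y - (qi \<triangleright> y) \<triangleleft> qi)"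

lemma qi_commuting_part_commutes:
  "qi \<triangleright> qi_commuting_part y = qi_commuting_part y \<triangleleft> qi"
  by (simp add: qi_commuting_part_def lact_scaleR ract_scaleR lact_diff_right ract_diff_left
      lact_ract lact_lact ract_ract qi_qi lact_minus_left ract_minus_right lact_one ract_one
      lact_minus_one ract_minus_one lact_minus_right add.commute)

lemma qi_commuting_part_eqI:
  assumes "qi \<triangleright> y = y \<triangleleft> qi"
  shows "qi_commuting_part y = y"
  by (simp add: qi_commuting_part_def assms ract_ract qi_qi ract_minus_one)

lemma qi_commuting_part_add: "qi_commuting_part (x + y) = qi_commuting_part x + qi_commuting_part y"
  by (simp add: qi_commuting_part_def lact_add_right ract_add_left algebra_simps)

lemma qi_commuting_part_scaleR: "qi_commuting_part (r *\<^sub>R x) = r *\<^sub>R qi_commuting_part x"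
  by (simp add: qi_commuting_part_def lact_scaleR ract_scaleR algebra_simps)

lemma star_qi_commuting_part:
  "star (qi_commuting_part x) = qi_commuting_part (star (x :: 'a::quat_star_algebra))"
  by (simp add: qi_commuting_part_def star_scaleR star_diff star_lact star_ract qcnj_qi
      lact_minus_left ract_minus_right ract_minus_left lact_minus_right lact_ract)

lemma norm_qi_commuting_part_le: "norm (qi_commuting_part x) \<le> norm (x :: 'a::quat_normed_space)"
  using norm_triangle_ineq4[of x "(qi \<triangleright> x) \<triangleleft> qi"] norm_lact_ract_le[of qi x qi]
  by (simp add: qi_commuting_part_def norm_qi)

text \<open>
  In \<open>b = b\<^sub>0 + c\<close> the part \<open>b\<^sub>0\<close> commutes and \<open>c\<close> anticommutes with \<open>i\<close>, so the mixed terms of \<open>b\<^sup>* b\<close>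
  anticommute with \<open>i\<close> and are annihilated.
\<close>

lemma qi_commuting_part_star_mult_self:
  fixes b :: "'a::quat_star_algebra"
  defines "c \<equiv> (1/2) *\<^sub>R (b + (qi \<triangleright> b) \<triangleleft> qi)"
  shows "qi_commuting_part (star b * b)
    = star (qi_commuting_part b) * qi_commuting_part b + star c * c"
proof -
  define u where "u = (qi \<triangleright> b) \<triangleleft> qi"
  have uu: "star u * u = - ((qi \<triangleright> (star b * b)) \<triangleleft> qi)"
  proof -
    have "star u * u = ((qi \<triangleright> star b) \<triangleleft> qi) * ((qi \<triangleright> b) \<triangleleft> qi)"
      by (simp add: u_def star_lact star_ract qcnj_qi lact_minus_left ract_minus_right lact_ract
          lact_minus_right ract_minus_left)
    also have "\<dots> = (qi \<triangleright> star b) * ((qi \<triangleright> (qi \<triangleright> b)) \<triangleleft> qi)"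
      by (subst ract_mult_lact) (simp only: lact_ract)
    also have "\<dots> = - ((qi \<triangleright> (star b * b)) \<triangleleft> qi)"
      by (simp add: lact_lact qi_qi lact_minus_one ract_minus_left lact_mult mult_ract lact_ract)
    finally show ?thesis .
  qed
  have b: "qi_commuting_part b = (1/2) *\<^sub>R (b - u)" "c = (1/2) *\<^sub>R (b + u)"
    by (simp_all add: qi_commuting_part_def c_def u_def)
  have "star (b - u) * (b - u) + star (b + u) * (b + u) = 2 *\<^sub>R (star b * b + star u * u)"
    by (simp add: star_add star_diff algebra_simps scaleR_2)
  then have "star (qi_commuting_part b) * qi_commuting_part b + star c * c
      = (1/4) *\<^sub>R (2 *\<^sub>R (star b * b + star u * u))"
    by (simp add: b star_scaleR flip: scaleR_add_right)
  then show ?thesis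
    by (simp add: qi_commuting_part_def uu)
qed

text \<open>
  The algebra is not represented multiplicatively: only \<open>qi_commuting_part y\<close> acts, which is enough to carry
  states of the multipliers back to the whole algebra.
\<close>

lift_definition left_mult :: "'a::quat_bstar_algebra \<Rightarrow> 'a multiplier"
  is "\<lambda>y. Blinfun (\<lambda>x. qi_commuting_part y * x)"
proof -
  fix y :: 'a
  have comm: "qi_commuting_part z * (qi \<triangleright> x) = qi \<triangleright> (qi_commuting_part z * x)" for z x :: 'a
    by (metis lact_mult qi_commuting_part_commutes ract_mult_lact)
  have "adjoint_pair (Blinfun (\<lambda>x. qi_commuting_part y * x)) (Blinfun (\<lambda>x. qi_commuting_part (star y) * x))"
    by (simp add: adjoint_pair_def bounded_linear_Blinfun_apply bounded_linear_mult_right comm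
        star_mult star_qi_commuting_part mult.assoc)
  then show "\<exists>S. adjoint_pair (Blinfun (\<lambda>x. qi_commuting_part y * x)) S" by blast
qed

lemma left_mult_apply: "blinfun_apply (Rep_multiplier (left_mult y)) x = qi_commuting_part y * x"
  by (simp add: left_mult.rep_eq bounded_linear_Blinfun_apply bounded_linear_mult_right)

lemma multiplier_eqI:
  assumes "\<And>x. blinfun_apply (Rep_multiplier S) x = blinfun_apply (Rep_multiplier T) x"
  shows "S = T"
  using assms by (metis blinfun_eqI Rep_multiplier_inject)

lemma left_mult_add: "left_mult (x + y) = left_mult x + left_mult y"
  by (rule multiplier_eqI)
     (simp add: left_mult_apply plus_multiplier.rep_eq plus_blinfun.rep_eq qi_commuting_part_add algebra_simps)

lemma left_mult_scaleR: "left_mult (r *\<^sub>R x) = r *\<^sub>R left_mult x"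
  by (rule multiplier_eqI)
     (simp add: left_mult_apply scaleR_multiplier.rep_eq scaleR_blinfun.rep_eq qi_commuting_part_scaleR)

lemma adj_left_mult: "adj (left_mult x) = left_mult (star x)"
  by (rule multiplier_eqI, rule star_mult_nondegenerate)
     (simp flip: adjoint_pairD[OF adjoint_pair_adj] star_qi_commuting_part
      add: left_mult_apply star_mult mult.assoc)

lemma left_mult_mult:
  assumes "qi \<triangleright> x = x \<triangleleft> qi" "qi \<triangleright> y = y \<triangleleft> qi"
  shows "left_mult (x * y) = left_mult x * left_mult y"
proof (rule multiplier_eqI)
  have "qi \<triangleright> (x * y) = (x * y) \<triangleleft> qi"
    by (metis assms lact_mult mult_ract ract_mult_lact)
  from this[THEN qi_commuting_part_eqI] assms[THEN qi_commuting_part_eqI]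
  show "blinfun_apply (Rep_multiplier (left_mult (x * y))) z
      = blinfun_apply (Rep_multiplier (left_mult x * left_mult y)) z" for z
    by (simp add: left_mult_apply times_multiplier.rep_eq mult.assoc)
qed

text \<open>
  Evaluating at \<open>e\<^sup>*\<close>, where \<open>\<parallel>e e\<^sup>*\<parallel> = \<parallel>e\<parallel>\<^sup>2\<close>, shows that passing to multipliers loses nothing.
\<close>

lemma norm_left_mult: "norm (left_mult y) = norm (qi_commuting_part y)"
proof (rule antisym)
  show "norm (left_mult y) \<le> norm (qi_commuting_part y)"
    unfolding norm_multiplier.rep_eq
    by (rule norm_blinfun_bound) (simp_all add: left_mult_apply norm_mult_ineq)
  define e where "e = qi_commuting_part y"
  have "norm e * norm e = norm (e * star e)"
    using norm_star_mult[of "star e"] by (simp add: star_star norm_star power2_eq_square)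
  also have "\<dots> \<le> norm (left_mult y) * norm e"
    using norm_blinfun[of "Rep_multiplier (left_mult y)" "star e"]
    by (simp add: left_mult_apply norm_multiplier.rep_eq norm_star e_def)
  finally show "norm (qi_commuting_part y) \<le> norm (left_mult y)"
    by (cases "norm e = 0") (simp_all add: e_def)
qed

text \<open>
  The anticommuting part \<open>c\<close> of \<open>b\<close> becomes commuting after multiplication by the unit \<open>j\<close>, and this leaves
  \<open>c\<^sup>* c\<close> unchanged.
\<close>

lemma left_mult_star_mult_self:
  fixes b :: "'a::quat_bstar_algebra"
  obtains s t where "left_mult (star b * b) = adj s * s + adj t * t"
    "norm b \<le> norm s + norm t"
proof -
  define c where "c = (1/2) *\<^sub>R (b + (qi \<triangleright> b) \<triangleleft> qi)"
  define d where "d = qj \<triangleright> c"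
  define b0 where "b0 = qi_commuting_part b"
  have b: "b = b0 + c"
    by (simp add: b0_def c_def qi_commuting_part_def algebra_simps flip: scaleR_add_left)
  have b0: "qi \<triangleright> b0 = b0 \<triangleleft> qi" by (simp add: b0_def qi_commuting_part_commutes)
  have c: "qi \<triangleright> c = - (c \<triangleleft> qi)"
    by (simp add: c_def lact_scaleR ract_scaleR lact_add_right ract_add_left
        lact_ract lact_lact ract_ract qi_qi lact_minus_left ract_minus_right lact_one ract_one
        lact_minus_one ract_minus_one lact_minus_right algebra_simps)
  have d: "qi \<triangleright> d = d \<triangleleft> qi"
    by (simp add: d_def lact_lact qi_qj lact_minus_left)
       (simp add: c lact_minus_right lact_ract flip: lact_lact)
  have dd: "star d * d = star c * c"
    by (simp add: d_def star_lact qcnj_qj ract_minus_right ract_mult_lact lact_lact qj_qj lact_minus_one)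
  have comm_star: "qi \<triangleright> star x = star x \<triangleleft> qi" if "qi \<triangleright> x = x \<triangleleft> qi" for x :: 'a
    using arg_cong[OF that, of star] by (simp add: star_lact star_ract qcnj_qi lact_minus_left ract_minus_right)
  have lm: "left_mult (star x * x) = adj (left_mult x) * left_mult x" if "qi \<triangleright> x = x \<triangleleft> qi" for x :: 'a
    using that by (simp add: adj_left_mult left_mult_mult comm_star)
  have "qi_commuting_part (star b * b) = star b0 * b0 + star d * d"
    unfolding b0_def dd c_def by (rule qi_commuting_part_star_mult_self)
  moreover have "left_mult y = left_mult (qi_commuting_part y)" for y :: 'a
    by (rule multiplier_eqI) (simp add: left_mult_apply qi_commuting_part_eqI qi_commuting_part_commutes)
  ultimately have "left_mult (star b * b) = adj (left_mult b0) * left_mult b0 + adj (left_mult d) * left_mult d"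
    by (metis left_mult_add lm b0 d)
  moreover have "norm b \<le> norm (left_mult b0) + norm (left_mult d)"
    using norm_triangle_ineq[of b0 c] b0 d
    by (simp add: norm_left_mult qi_commuting_part_eqI d_def norm_lact norm_qj flip: b)
  ultimately show thesis by (rule that)
qed

text \<open>
  The functional is a state of the multipliers that attains the norm of \<open>left_mult (a\<^sup>* a) = s\<^sup>* s + t\<^sup>* t\<close>.
  Monotonicity bounds this norm below by \<open>\<parallel>s\<parallel>\<^sup>2\<close> and by \<open>\<parallel>t\<parallel>\<^sup>2\<close>, and \<open>\<parallel>a\<parallel> \<le> \<parallel>s\<parallel> + \<parallel>t\<parallel>\<close> accounts for the
  factor \<open>1/4\<close>.
\<close>

theorem quat_bstar_state_exists:
  fixes a :: "'a::quat_bstar_algebra"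
  shows "\<exists>g. linear g \<and> (\<forall>x. g (star x) = g x) \<and> (\<forall>x. 0 \<le> g (star x * x)) \<and>
    (\<forall>x. \<bar>g x\<bar> \<le> norm x) \<and> (norm a)\<^sup>2 / 4 \<le> g (star a * a)"
proof -
  obtain s t where st: "left_mult (star a * a) = adj s * s + adj t * t" "norm a \<le> norm s + norm t"
    by (rule left_mult_star_mult_self)
  have pos: "cstar_pos (left_mult (star x * x))" for x :: 'a
    by (metis left_mult_star_mult_self cstar_pos_add cstar_pos_adj_mult_self)
  obtain f where f: "linear f" "\<And>x. f (adj x) = f x" "\<And>x. cstar_pos x \<Longrightarrow> 0 \<le> f x"
    "\<And>x. \<bar>f x\<bar> \<le> norm x" "f (left_mult (star a * a)) = norm (left_mult (star a * a))"
    using cstar_state_exists[OF pos] by blast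
  have "(norm s)\<^sup>2 \<le> norm (adj s * s + adj t * t)"
    by (rule order_trans[OF norm_adj_mult_ge norm_le_norm_add_cstar_pos]) (rule cstar_pos_adj_mult_self)+
  moreover have "(norm t)\<^sup>2 \<le> norm (adj t * t + adj s * s)"
    by (rule order_trans[OF norm_adj_mult_ge norm_le_norm_add_cstar_pos]) (rule cstar_pos_adj_mult_self)+
  moreover have "(norm a)\<^sup>2 \<le> (norm s + norm t)\<^sup>2"
    using st(2) by (intro power_mono) auto
  moreover have "(norm s + norm t)\<^sup>2 \<le> 2 * (norm s)\<^sup>2 + 2 * (norm t)\<^sup>2"
    using zero_le_power2[of "norm s - norm t"] by (simp add: power2_eq_square algebra_simps)
  ultimately have "(norm a)\<^sup>2 / 4 \<le> f (left_mult (star a * a))"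
    using f(5) unfolding st(1) add.commute[of "adj t * t"] by linarith
  moreover have "\<bar>f (left_mult x)\<bar> \<le> norm x" for x :: 'a
    using f(4)[of "left_mult x"] norm_qi_commuting_part_le[of x] by (simp add: norm_left_mult)
  moreover have "linear (\<lambda>x. f (left_mult x))"
    using f(1) by (intro linearI) (simp_all add: left_mult_add left_mult_scaleR linear_add linear_cmul)
  moreover have "f (left_mult (star x)) = f (left_mult x)" for x :: 'a
    by (simp add: f(2) flip: adj_left_mult)
  ultimately show ?thesis using f(3)[OF pos] by blast
qed

section \<open>The Hilbert space of bounded functionals on a semi-inner product space\<close>

class semi_inner_space = real_vector +
  fixes semi_inner :: "'a \<Rightarrow> 'a \<Rightarrow> real"
  assumes semi_inner_add_left: "semi_inner (x + y) z = semi_inner x z + semi_inner y z"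
    and semi_inner_scaleR_left: "semi_inner (r *\<^sub>R x) y = r * semi_inner x y"
    and semi_inner_commute: "semi_inner x y = semi_inner y x"
    and semi_inner_ge_zero: "0 \<le> semi_inner x x"

lemma semi_inner_add_right: "semi_inner x (y + z) = semi_inner x y + semi_inner x z"
  by (metis semi_inner_add_left semi_inner_commute)

lemma semi_inner_scaleR_right: "semi_inner x (r *\<^sub>R y) = r * semi_inner x y"
  by (metis semi_inner_scaleR_left semi_inner_commute)

lemma semi_inner_diff_left: "semi_inner (x - y) z = semi_inner x z - semi_inner y z"
  using semi_inner_add_left[of x "- y" z] semi_inner_scaleR_left[of "-1" y z] by simp

lemma semi_inner_diff_right: "semi_inner x (y - z) = semi_inner x y - semi_inner x z"
  by (metis semi_inner_diff_left semi_inner_commute)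

lemma linear_semi_inner: "linear (semi_inner x)"
  by (rule linearI) (simp_all add: semi_inner_add_right semi_inner_scaleR_right)

lemma Cauchy_Schwarz_form:
  fixes B :: "'v::real_vector \<Rightarrow> 'v \<Rightarrow> real"
  assumes add: "\<And>x y z. B (x + y) z = B x z + B y z"
    and scale: "\<And>r x y. B (r *\<^sub>R x) y = r * B x y"
    and sym: "\<And>x y. B x y = B y x"
    and pos: "\<And>x. 0 \<le> B x x"
  shows "(B x y)\<^sup>2 \<le> B x x * B y y"
proof -
  have add': "B z (x + y) = B z x + B z y" and scale': "B y (r *\<^sub>R x) = r * B y x" for x y z r
    using add[of x y z] scale[of r x y] by (simp_all add: sym)
  have *: "0 \<le> B x x + 2 * t * B x y + t\<^sup>2 * B y y" for t
    using pos[of "x + t *\<^sub>R y"] sym[of y x]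
    by (simp add: add add' scale scale' power2_eq_square algebra_simps)
  show ?thesis
  proof (cases "B y y = 0")
    case True
    have "B x y = 0"
    proof (rule ccontr)
      assume "B x y \<noteq> 0"
      then show False
        using *[of "- (B x x + 1) / (2 * B x y)"] True by (simp add: field_simps)
    qed
    then show ?thesis by (simp add: True)
  next
    case False
    with pos[of y] have "0 < B y y" by simp
    then have "0 \<le> (B x x * B y y - (B x y)\<^sup>2) / B y y"
      using *[of "- B x y / B y y"] by (simp add: power2_eq_square field_simps)
    then show ?thesis using \<open>0 < B y y\<close> by (simp add: zero_le_divide_iff)
  qed
qed

lemma semi_inner_Cauchy_Schwarz: "(semi_inner x y)\<^sup>2 \<le> semi_inner x x * semi_inner y y"
  by (rule Cauchy_Schwarz_form[OF semi_inner_add_left semi_inner_scaleR_left semi_inner_commute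
        semi_inner_ge_zero])

definition snorm :: "'d::semi_inner_space \<Rightarrow> real" where
  "snorm d = sqrt (semi_inner d d)"

lemma snorm_ge_zero [simp]: "0 \<le> snorm d"
  by (simp add: snorm_def semi_inner_ge_zero)

lemma snorm_power2: "(snorm d)\<^sup>2 = semi_inner d d"
  by (simp add: snorm_def semi_inner_ge_zero)

lemma snorm_scaleR: "snorm (r *\<^sub>R d) = \<bar>r\<bar> * snorm d"
  unfolding snorm_def semi_inner_scaleR_left semi_inner_scaleR_right mult.assoc[symmetric] real_sqrt_mult
  by simp

lemma abs_semi_inner_le: "\<bar>semi_inner x y\<bar> \<le> snorm x * snorm y"
proof (rule power2_le_imp_le)
  show "\<bar>semi_inner x y\<bar>\<^sup>2 \<le> (snorm x * snorm y)\<^sup>2"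
    using semi_inner_Cauchy_Schwarz[of x y] by (simp add: power_mult_distrib snorm_power2)
qed simp

text \<open>
  The completion of a semi-inner product space modulo its null vectors, realised as its space of bounded
  functionals.  Completeness is immediate in this form, and an operator with an adjoint acts by
  composition with that adjoint, so nothing has to be extended by continuity.
\<close>

typedef (overloaded) 'd::semi_inner_space sdual =
  "{F :: 'd \<Rightarrow> real. linear F \<and> (\<exists>K. \<forall>d. \<bar>F d\<bar> \<le> K * snorm d)}"
  morphisms sdual_apply Abs_sdual
proof -
  have "(\<lambda>_. 0) \<in> {F :: 'd \<Rightarrow> real. linear F \<and> (\<exists>K. \<forall>d. \<bar>F d\<bar> \<le> K * snorm d)}"
    by (auto intro!: linearI exI[of _ 0])
  then show ?thesis by blast
qed

setup_lifting type_definition_sdual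

lemma linear_sdual_apply: "linear (sdual_apply F)"
  using sdual_apply[of F] by simp

lemma sdual_eqI: "(\<And>d. sdual_apply F d = sdual_apply G d) \<Longrightarrow> F = G"
  by (metis sdual_apply_inject ext)

lemma sdual_apply_Abs:
  assumes "linear f" "\<And>d. \<bar>f d\<bar> \<le> K * snorm d"
  shows "sdual_apply (Abs_sdual f) = f"
  using assms by (intro Abs_sdual_inverse) blast

instantiation sdual :: (semi_inner_space) real_vector
begin

lift_definition zero_sdual :: "'a sdual" is "\<lambda>_. 0"
  by (auto intro!: linearI exI[of _ 0])

lift_definition plus_sdual :: "'a sdual \<Rightarrow> 'a sdual \<Rightarrow> 'a sdual" is "\<lambda>F G d. F d + G d"
proof safe
  fix F G :: "'a \<Rightarrow> real" and K L
  assume F: "linear F" "\<forall>d. \<bar>F d\<bar> \<le> K * snorm d" and G: "linear G" "\<forall>d. \<bar>G d\<bar> \<le> L * snorm d"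
  show "linear (\<lambda>d. F d + G d)"
    by (rule linear_compose_add[OF F(1) G(1)])
  have "\<bar>F d + G d\<bar> \<le> (K + L) * snorm d" for d
    using F(2)[rule_format, of d] G(2)[rule_format, of d] by (simp add: algebra_simps)
  then show "\<exists>K. \<forall>d. \<bar>F d + G d\<bar> \<le> K * snorm d" by blast
qed

lift_definition scaleR_sdual :: "real \<Rightarrow> 'a sdual \<Rightarrow> 'a sdual" is "\<lambda>r F d. r * F d"
proof safe
  fix F :: "'a \<Rightarrow> real" and K r
  assume F: "linear F" "\<forall>d. \<bar>F d\<bar> \<le> K * snorm d"
  then show "linear (\<lambda>d. r * F d)"
    using linear_compose_scale_right[of F r] by simp
  have "\<bar>r * F d\<bar> \<le> (\<bar>r\<bar> * K) * snorm d" for d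
    using F(2)[rule_format, of d] by (simp add: abs_mult mult.assoc mult_left_mono)
  then show "\<exists>K. \<forall>d. \<bar>r * F d\<bar> \<le> K * snorm d" by blast
qed

definition uminus_sdual :: "'a sdual \<Rightarrow> 'a sdual" where "- (F :: 'a sdual) = (-1) *\<^sub>R F"
definition minus_sdual :: "'a sdual \<Rightarrow> 'a sdual \<Rightarrow> 'a sdual" where "F - G = F + - (G :: 'a sdual)"

instance
proof
  fix x y z :: "'a sdual" and r s :: real
  show "x + y + z = x + (y + z)"
    by transfer (simp add: add.assoc)
  show "x + y = y + x"
    by transfer (simp add: add.commute)
  show "0 + x = x"
    by transfer simp
  show "- x + x = 0"
    unfolding uminus_sdual_def by transfer simp
  show "x - y = x + - y"
    by (rule minus_sdual_def)
  show "r *\<^sub>R (x + y) = r *\<^sub>R x + r *\<^sub>R y"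
    by transfer (simp add: distrib_left)
  show "(r + s) *\<^sub>R x = r *\<^sub>R x + s *\<^sub>R x"
    by transfer (simp add: distrib_right)
  show "r *\<^sub>R s *\<^sub>R x = (r * s) *\<^sub>R x"
    by transfer (simp add: mult.assoc)
  show "1 *\<^sub>R x = x"
    by transfer simp
qed

end

lemma sdual_apply_diff: "sdual_apply (F - G) d = sdual_apply F d - sdual_apply G d"
  unfolding minus_sdual_def uminus_sdual_def plus_sdual.rep_eq scaleR_sdual.rep_eq by simp

instantiation sdual :: (semi_inner_space) real_normed_vector
begin

definition norm_sdual :: "'a sdual \<Rightarrow> real" where
  "norm_sdual F = (SUP d\<in>{d. snorm d \<le> 1}. \<bar>sdual_apply F d\<bar>)"
definition dist_sdual :: "'a sdual \<Rightarrow> 'a sdual \<Rightarrow> real" where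
  "dist_sdual x y = norm (x - y)"
definition sgn_sdual :: "'a sdual \<Rightarrow> 'a sdual" where
  "sgn_sdual x = x /\<^sub>R norm x"
definition uniformity_sdual :: "('a sdual \<times> 'a sdual) filter" where
  "uniformity_sdual = (INF e\<in>{0 <..}. principal {(x, y). dist x y < e})"
definition open_sdual :: "'a sdual set \<Rightarrow> bool" where
  "open_sdual U \<longleftrightarrow> (\<forall>x\<in>U. eventually (\<lambda>(x', y). x' = x \<longrightarrow> y \<in> U) uniformity)"

lemma sdual_norm_bound:
  fixes F :: "'a sdual"
  assumes "0 \<le> K" "\<And>d. \<bar>sdual_apply F d\<bar> \<le> K * snorm d"
  shows "norm F \<le> K"
  unfolding norm_sdual_def
proof (rule cSUP_least)
  show "{d :: 'a. snorm d \<le> 1} \<noteq> {}"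
    using snorm_scaleR[of 0 "0 :: 'a"] by (auto intro!: exI[of _ 0])
  fix d :: 'a assume "d \<in> {d. snorm d \<le> 1}"
  then have "K * snorm d \<le> K * 1"
    using assms(1) by (intro mult_left_mono) auto
  then show "\<bar>sdual_apply F d\<bar> \<le> K"
    using assms(2)[of d] by simp
qed

lemma bdd_above_sdual_apply: "bdd_above ((\<lambda>d. \<bar>sdual_apply F d\<bar>) ` {d :: 'a. snorm d \<le> 1})"
proof -
  obtain K where K: "\<And>d. \<bar>sdual_apply F d\<bar> \<le> K * snorm d"
    using sdual_apply[of F] by auto
  show ?thesis
  proof (rule bdd_aboveI2)
    fix d :: 'a assume "d \<in> {d. snorm d \<le> 1}"
    then have "K * snorm d \<le> \<bar>K\<bar> * 1" by (intro mult_mono) auto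
    then show "\<bar>sdual_apply F d\<bar> \<le> \<bar>K\<bar>" using K[of d] by simp
  qed
qed

lemma abs_sdual_apply_le: "\<bar>sdual_apply F d\<bar> \<le> norm F * snorm (d :: 'a)"
proof -
  obtain K where K: "\<And>d. \<bar>sdual_apply F d\<bar> \<le> K * snorm d"
    using sdual_apply[of F] by auto
  show ?thesis
  proof (cases "snorm d = 0")
    case True
    then show ?thesis using K[of d] by simp
  next
    case False
    then have pos: "0 < snorm d" using snorm_ge_zero[of d] by linarith
    have "\<bar>sdual_apply F ((1 / snorm d) *\<^sub>R d)\<bar> \<le> norm F"
      unfolding norm_sdual_def using bdd_above_sdual_apply pos by (intro cSUP_upper) (auto simp: snorm_scaleR)
    then show ?thesis
      using pos by (simp add: linear_cmul[OF linear_sdual_apply] abs_mult field_simps)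
  qed
qed

instance
proof
  fix x y :: "'a sdual" and r :: real
  have nonneg: "0 \<le> norm F" for F :: "'a sdual"
  proof -
    have "0 \<le> \<bar>sdual_apply F 0\<bar>" by simp
    also have "\<dots> \<le> norm F"
      unfolding norm_sdual_def using bdd_above_sdual_apply
      by (rule cSUP_upper2[of _ _ 0]) (simp_all add: snorm_def linear_0[OF linear_semi_inner])
    finally show ?thesis .
  qed
  show "norm x = 0 \<longleftrightarrow> x = 0"
  proof
    assume "norm x = 0"
    then show "x = 0"
      using abs_sdual_apply_le[of x] by (intro sdual_eqI) (simp add: zero_sdual.rep_eq)
  next
    assume "x = 0"
    then show "norm x = 0"
      using sdual_norm_bound[of 0 x] nonneg[of x] by (simp add: zero_sdual.rep_eq)
  qed
  show "norm (x + y) \<le> norm x + norm y"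
  proof (rule sdual_norm_bound)
    fix d
    show "\<bar>sdual_apply (x + y) d\<bar> \<le> (norm x + norm y) * snorm d"
      using abs_sdual_apply_le[of x d] abs_sdual_apply_le[of y d]
      by (simp add: plus_sdual.rep_eq algebra_simps)
  qed (simp add: nonneg)
  have scale_le: "norm (r *\<^sub>R x) \<le> \<bar>r\<bar> * norm x" for r and x :: "'a sdual"
  proof (rule sdual_norm_bound)
    fix d
    show "\<bar>sdual_apply (r *\<^sub>R x) d\<bar> \<le> \<bar>r\<bar> * norm x * snorm d"
      using mult_left_mono[OF abs_sdual_apply_le[of x d], of "\<bar>r\<bar>"]
      by (simp add: scaleR_sdual.rep_eq abs_mult mult.assoc)
  qed (simp add: nonneg)
  show "norm (r *\<^sub>R x) = \<bar>r\<bar> * norm x"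
  proof (cases "r = 0")
    case True
    then show ?thesis using scale_le[of 0 x] nonneg[of "0 *\<^sub>R x"] by simp
  next
    case False
    have "norm x \<le> \<bar>inverse r\<bar> * norm (r *\<^sub>R x)"
      using scale_le[of "inverse r" "r *\<^sub>R x"] False by simp
    then show ?thesis
      using scale_le[of r x] False by (simp add: field_simps)
  qed
qed (simp_all add: dist_sdual_def sgn_sdual_def uniformity_sdual_def open_sdual_def)

end

definition semi_inner_rep :: "'d::semi_inner_space \<Rightarrow> 'd sdual" where
  "semi_inner_rep d = Abs_sdual (semi_inner d)"

lemma semi_inner_rep_apply: "sdual_apply (semi_inner_rep d) e = semi_inner d e"
  by (simp add: semi_inner_rep_def sdual_apply_Abs[OF linear_semi_inner abs_semi_inner_le])

lemma semi_inner_rep_add: "semi_inner_rep (d + e) = semi_inner_rep d + semi_inner_rep e"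
  by (rule sdual_eqI) (simp add: semi_inner_rep_apply plus_sdual.rep_eq semi_inner_add_left)

lemma semi_inner_rep_scaleR: "semi_inner_rep (r *\<^sub>R d) = r *\<^sub>R semi_inner_rep d"
  by (rule sdual_eqI) (simp add: semi_inner_rep_apply scaleR_sdual.rep_eq semi_inner_scaleR_left)

lemma semi_inner_rep_diff: "semi_inner_rep (d - e) = semi_inner_rep d - semi_inner_rep e"
  using semi_inner_rep_add[of d "- e"] semi_inner_rep_scaleR[of "-1" e] by simp

lemma norm_semi_inner_rep: "norm (semi_inner_rep d) = snorm d"
proof (rule antisym)
  show "norm (semi_inner_rep d) \<le> snorm d"
    by (rule sdual_norm_bound) (simp_all add: semi_inner_rep_apply abs_semi_inner_le)
  have "snorm d * snorm d \<le> norm (semi_inner_rep d) * snorm d"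
    using abs_sdual_apply_le[of "semi_inner_rep d" d]
    by (simp add: semi_inner_rep_apply semi_inner_ge_zero flip: snorm_power2 power2_eq_square)
  then show "snorm d \<le> norm (semi_inner_rep d)"
    by (cases "snorm d = 0") (use snorm_ge_zero[of d] in \<open>auto simp: mult_le_cancel_right\<close>)
qed

text \<open>
  The functional \<open>J\<close> is bounded below, and \<open>d\<close> is chosen to minimise it up to \<open>\<epsilon>\<^sup>2\<close>.  The quadratic polynomial
  \<open>t \<mapsto> J (d + t e)\<close> cannot fall by more than \<open>\<epsilon>\<^sup>2\<close> below its value at 0, which bounds its linear coefficient
  \<open>- 2 (G e)\<close>, where \<open>G = F - semi_inner_rep d\<close>.
\<close>

lemma semi_inner_rep_dense:
  fixes F :: "'d::semi_inner_space sdual"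
  assumes "0 < \<epsilon>"
  obtains d where "norm (F - semi_inner_rep d) \<le> \<epsilon>"
proof -
  define J where "J d = semi_inner d d - 2 * sdual_apply F d" for d
  have J_ge: "- (norm F)\<^sup>2 \<le> J d" for d
    using abs_sdual_apply_le[of F d] zero_le_power2[of "norm F - snorm d"]
    by (simp add: J_def power2_diff snorm_power2 abs_le_iff)
  then have bdd: "bdd_below (range J)" by (rule bdd_belowI2)
  obtain d where d: "J d < Inf (range J) + \<epsilon>\<^sup>2"
    using cInf_lessD[of "range J" "Inf (range J) + \<epsilon>\<^sup>2"] assms by auto
  have J_le: "J d - \<epsilon>\<^sup>2 \<le> J e" for e
    using d cInf_lower[OF rangeI bdd, of e] by simp
  define G where "G = F - semi_inner_rep d"
  have expand: "J (d + t *\<^sub>R e) = J d - 2 * t * sdual_apply G e + t\<^sup>2 * semi_inner e e" for t e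
    using semi_inner_commute[of e d]
    by (simp add: J_def G_def sdual_apply_diff semi_inner_rep_apply linear_add[OF linear_sdual_apply]
        linear_cmul[OF linear_sdual_apply] semi_inner_add_left semi_inner_add_right
        semi_inner_scaleR_left semi_inner_scaleR_right power2_eq_square algebra_simps)
  have "norm G \<le> \<epsilon>"
  proof (rule sdual_norm_bound)
    fix e
    show "\<bar>sdual_apply G e\<bar> \<le> \<epsilon> * snorm e"
    proof (cases "snorm e = 0")
      case True
      then show ?thesis using abs_sdual_apply_le[of G e] by simp
    next
      case False
      then have pos: "0 < semi_inner e e"
        using semi_inner_ge_zero[of e] by (simp add: snorm_def)
      have "(sdual_apply G e)\<^sup>2 / semi_inner e e \<le> \<epsilon>\<^sup>2"
        using J_le[of "d + (sdual_apply G e / semi_inner e e) *\<^sub>R e"] pos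
        by (simp add: expand power2_eq_square field_simps)
      then have "(sdual_apply G e)\<^sup>2 \<le> (\<epsilon> * snorm e)\<^sup>2"
        using pos by (simp add: power_mult_distrib snorm_power2 field_simps)
      then show ?thesis
        using assms by (simp flip: abs_le_square_iff add: abs_mult)
    qed
  qed (use assms in simp)
  then show thesis using that by (simp add: G_def)
qed

lemma semi_inner_rep_limit:
  obtains d where "(\<lambda>n. semi_inner_rep (d n)) \<longlonglongrightarrow> F"
proof -
  have "\<exists>d. norm (F - semi_inner_rep d) \<le> inverse (real (Suc n))" for n
    using semi_inner_rep_dense[of "inverse (real (Suc n))" F] by auto
  then obtain d where d: "\<And>n. norm (F - semi_inner_rep (d n)) \<le> inverse (real (Suc n))" by metis
  have "(\<lambda>n. F - semi_inner_rep (d n)) \<longlonglongrightarrow> 0"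
    using d by (intro Lim_null_comparison[OF _ LIMSEQ_inverse_real_of_nat]) auto
  from tendsto_diff[OF tendsto_const[of F] this] show thesis
    by (intro that[of d]) simp
qed

instantiation sdual :: (semi_inner_space) real_inner
begin

definition inner_sdual :: "'a sdual \<Rightarrow> 'a sdual \<Rightarrow> real" where
  "inner_sdual F G = ((norm (F + G))\<^sup>2 - (norm (F - G))\<^sup>2) / 4"

text \<open>
  The inner product is defined by polarisation; its bilinearity follows from this lemma by approximating
  functionals by vectors.
\<close>

lemma tendsto_semi_inner:
  fixes F G :: "'a sdual"
  assumes "(\<lambda>n. semi_inner_rep (d n)) \<longlonglongrightarrow> F" "(\<lambda>n. semi_inner_rep (e n)) \<longlonglongrightarrow> G"
  shows "(\<lambda>n. semi_inner (d n) (e n)) \<longlonglongrightarrow> F \<bullet> G"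
proof -
  have "semi_inner x y = ((norm (semi_inner_rep x + semi_inner_rep y))\<^sup>2
      - (norm (semi_inner_rep x - semi_inner_rep y))\<^sup>2) / 4" for x y :: 'a
    unfolding semi_inner_rep_add[symmetric] semi_inner_rep_diff[symmetric] norm_semi_inner_rep snorm_power2
    by (simp add: semi_inner_add_left semi_inner_add_right semi_inner_diff_left semi_inner_diff_right
        semi_inner_commute[of y x])
  then show ?thesis
    unfolding inner_sdual_def by (simp only:) (intro tendsto_intros assms; simp)
qed

instance
proof
  fix x y z :: "'a sdual" and r :: real
  obtain dx where dx: "(\<lambda>n. semi_inner_rep (dx n)) \<longlonglongrightarrow> x" by (rule semi_inner_rep_limit)
  obtain dy where dy: "(\<lambda>n. semi_inner_rep (dy n)) \<longlonglongrightarrow> y" by (rule semi_inner_rep_limit)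
  obtain dz where dz: "(\<lambda>n. semi_inner_rep (dz n)) \<longlonglongrightarrow> z" by (rule semi_inner_rep_limit)
  show "x \<bullet> y = y \<bullet> x"
    by (simp add: inner_sdual_def add.commute norm_minus_commute)
  have "(\<lambda>n. semi_inner_rep (dx n + dy n)) \<longlonglongrightarrow> x + y"
    unfolding semi_inner_rep_add by (intro tendsto_intros dx dy)
  from tendsto_semi_inner[OF this dz] show "(x + y) \<bullet> z = x \<bullet> z + y \<bullet> z"
    using tendsto_add[OF tendsto_semi_inner[OF dx dz] tendsto_semi_inner[OF dy dz]] LIMSEQ_unique
    unfolding semi_inner_add_left by blast
  have "(\<lambda>n. semi_inner_rep (r *\<^sub>R dx n)) \<longlonglongrightarrow> r *\<^sub>R x"
    unfolding semi_inner_rep_scaleR by (intro tendsto_intros dx)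
  from tendsto_semi_inner[OF this dy] show "(r *\<^sub>R x) \<bullet> y = r * (x \<bullet> y)"
    using tendsto_mult_left[OF tendsto_semi_inner[OF dx dy], of r] LIMSEQ_unique
    unfolding semi_inner_scaleR_left by blast
  have self: "u \<bullet> u = (norm u)\<^sup>2" for u :: "'a sdual"
    using norm_scaleR[of 2 u] by (simp add: inner_sdual_def scaleR_2 power_mult_distrib)
  show "0 \<le> x \<bullet> x" "x \<bullet> x = 0 \<longleftrightarrow> x = 0" "norm x = sqrt (x \<bullet> x)"
    by (simp_all add: self)
qed

end

lemma inner_semi_inner_rep: "semi_inner_rep d \<bullet> G = sdual_apply G d"
proof -
  obtain e where e: "(\<lambda>n. semi_inner_rep (e n)) \<longlonglongrightarrow> G" by (rule semi_inner_rep_limit)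
  have "(\<lambda>n. semi_inner d (e n)) \<longlonglongrightarrow> semi_inner_rep d \<bullet> G"
    by (rule tendsto_semi_inner[OF tendsto_const e])
  moreover have "(\<lambda>n. semi_inner d (e n)) \<longlonglongrightarrow> sdual_apply G d"
  proof (rule metric_tendsto_imp_tendsto)
    show "(\<lambda>n. snorm d *\<^sub>R (semi_inner_rep (e n) - G)) \<longlonglongrightarrow> snorm d *\<^sub>R (G - G)"
      by (intro tendsto_intros e)
    show "\<forall>\<^sub>F n in sequentially. dist (semi_inner d (e n)) (sdual_apply G d)
        \<le> dist (snorm d *\<^sub>R (semi_inner_rep (e n) - G)) (snorm d *\<^sub>R (G - G))"
      using abs_sdual_apply_le[of "semi_inner_rep (e _) - G" d]
      by (simp add: dist_norm sdual_apply_diff semi_inner_rep_apply semi_inner_commute[of d] mult.commute)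
  qed
  ultimately show ?thesis by (rule LIMSEQ_unique)
qed

instance sdual :: (semi_inner_space) complete_space
proof
  fix X :: "nat \<Rightarrow> 'a sdual" assume X: "Cauchy X"
  have apply_le: "\<bar>sdual_apply (X m) d - sdual_apply (X n) d\<bar> \<le> norm (X m - X n) * snorm d" for m n d
    using abs_sdual_apply_le[of "X m - X n" d] by (simp add: sdual_apply_diff)
  have "convergent (\<lambda>n. sdual_apply (X n) d)" for d
  proof (rule Cauchy_convergent, rule metric_CauchyI)
    fix e :: real assume "0 < e"
    then have "0 < e / (snorm d + 1)" using snorm_ge_zero[of d] by (intro divide_pos_pos) linarith+
    then obtain M where M: "\<And>m n. m \<ge> M \<Longrightarrow> n \<ge> M \<Longrightarrow> norm (X m - X n) < e / (snorm d + 1)"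
      using X[unfolded Cauchy_iff] by metis
    have "dist (sdual_apply (X m) d) (sdual_apply (X n) d) < e" if "m \<ge> M" "n \<ge> M" for m n
    proof -
      have "norm (X m - X n) * snorm d \<le> norm (X m - X n) * (snorm d + 1)"
        by (intro mult_left_mono) auto
      also have "\<dots> < e"
        using M[OF that] snorm_ge_zero[of d] by (simp add: pos_less_divide_eq)
      finally show ?thesis using apply_le[of m d n] by (simp add: dist_real_def)
    qed
    then show "\<exists>M. \<forall>m\<ge>M. \<forall>n\<ge>M. dist (sdual_apply (X m) d) (sdual_apply (X n) d) < e" by blast
  qed
  then obtain L where L: "\<And>d. (\<lambda>n. sdual_apply (X n) d) \<longlonglongrightarrow> L d"
    unfolding convergent_def by metis
  have close: "\<bar>sdual_apply (X m) d - L d\<bar> \<le> e * snorm d"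
    if "\<And>n. n \<ge> M \<Longrightarrow> norm (X m - X n) < e" for m M e d
  proof (rule tendsto_upperbound)
    show "(\<lambda>n. \<bar>sdual_apply (X m) d - sdual_apply (X n) d\<bar>) \<longlonglongrightarrow> \<bar>sdual_apply (X m) d - L d\<bar>"
      by (intro tendsto_intros L)
    show "\<forall>\<^sub>F n in sequentially. \<bar>sdual_apply (X m) d - sdual_apply (X n) d\<bar> \<le> e * snorm d"
      using eventually_ge_at_top[of M]
    proof eventually_elim
      case (elim n)
      then show ?case
        using mult_right_mono[of "norm (X m - X n)" e "snorm d"] apply_le[of m d n] that[of n] by simp
    qed
  qed simp
  have lin: "linear L"
  proof (rule linearI)
    fix x y :: 'a and r :: real
    show "L (x + y) = L x + L y"
      using LIMSEQ_unique[OF L[of "x + y"]] tendsto_add[OF L[of x] L[of y]]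
      by (simp add: linear_add[OF linear_sdual_apply])
    show "L (r *\<^sub>R x) = r *\<^sub>R L x"
      using LIMSEQ_unique[OF L[of "r *\<^sub>R x"]] tendsto_mult_left[OF L[of x], of r]
      by (simp add: linear_cmul[OF linear_sdual_apply])
  qed
  obtain M where M: "\<And>m n. m \<ge> M \<Longrightarrow> n \<ge> M \<Longrightarrow> norm (X m - X n) < 1"
    using X[unfolded Cauchy_iff, rule_format, of 1] by auto
  have "\<bar>L d\<bar> \<le> (norm (X M) + 1) * snorm d" for d
    using close[of M M 1 d] M[of M] abs_sdual_apply_le[of "X M" d] by (simp add: algebra_simps)
  then have AL: "sdual_apply (Abs_sdual L) = L"
    by (rule sdual_apply_Abs[OF lin])
  have "X \<longlonglongrightarrow> Abs_sdual L"
  proof (rule LIMSEQ_I)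
    fix e :: real assume "0 < e"
    then obtain M where M: "\<And>m n. m \<ge> M \<Longrightarrow> n \<ge> M \<Longrightarrow> norm (X m - X n) < e / 2"
      using X[unfolded Cauchy_iff, rule_format, of "e / 2"] by auto
    have "norm (X n - Abs_sdual L) < e" if "n \<ge> M" for n
    proof -
      have "norm (X n - Abs_sdual L) \<le> e / 2"
        using close[of M n "e / 2"] M[OF that] \<open>0 < e\<close>
        by (intro sdual_norm_bound) (auto simp: sdual_apply_diff AL)
      then show ?thesis using \<open>0 < e\<close> by simp
    qed
    then show "\<exists>M. \<forall>n\<ge>M. norm (X n - Abs_sdual L) < e" by blast
  qed
  then show "convergent X" by (auto simp: convergent_def)
qed

definition sdual_comp :: "('d::semi_inner_space \<Rightarrow> 'd) \<Rightarrow> 'd sdual \<Rightarrow> 'd sdual" where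
  "sdual_comp T F = Abs_sdual (\<lambda>d. sdual_apply F (T d))"

lemma sdual_comp_apply:
  assumes T: "linear T" "\<And>d. snorm (T d) \<le> C * snorm d"
  shows "sdual_apply (sdual_comp T F) d = sdual_apply F (T d)"
proof -
  have "\<bar>sdual_apply F (T d)\<bar> \<le> (norm F * C) * snorm d" for d
    using abs_sdual_apply_le[of F "T d"] mult_left_mono[OF T(2)[of d], of "norm F"] by simp
  moreover have "linear (\<lambda>d. sdual_apply F (T d))"
    using linear_compose[OF T(1) linear_sdual_apply] by (simp add: o_def)
  ultimately show ?thesis
    unfolding sdual_comp_def by (subst sdual_apply_Abs) auto
qed

lemma norm_sdual_comp_le:
  assumes T: "linear T" "\<And>d. snorm (T d) \<le> C * snorm d" and "0 \<le> C"
  shows "norm (sdual_comp T F) \<le> C * norm F"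
proof (rule sdual_norm_bound)
  show "\<bar>sdual_apply (sdual_comp T F) d\<bar> \<le> C * norm F * snorm d" for d
    using abs_sdual_apply_le[of F "T d"] mult_left_mono[OF T(2)[of d], of "norm F"]
    by (simp add: sdual_comp_apply[OF T] algebra_simps)
qed (use assms in simp)

lemma bounded_linear_sdual_comp:
  assumes T: "linear T" "\<And>d. snorm (T d) \<le> C * snorm d" and "0 \<le> C"
  shows "bounded_linear (sdual_comp T)"
proof (rule bounded_linear_intro)
  fix F G :: "'a sdual" and r
  note ap = sdual_comp_apply[OF T]
  show "sdual_comp T (F + G) = sdual_comp T F + sdual_comp T G"
    by (rule sdual_eqI) (simp add: ap plus_sdual.rep_eq)
  show "sdual_comp T (r *\<^sub>R F) = r *\<^sub>R sdual_comp T F"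
    by (rule sdual_eqI) (simp add: ap scaleR_sdual.rep_eq)
  show "norm (sdual_comp T F) \<le> norm F * C"
    using norm_sdual_comp_le[OF assms, of F] by (simp add: mult.commute)
qed

text \<open>
  Composition with \<open>T\<close> sends the functional of a vector \<open>d\<close> to that of \<open>S d\<close>, and such functionals are dense.
\<close>

lemma inner_sdual_comp:
  assumes T: "linear T" "\<And>d. snorm (T d) \<le> C * snorm d" "0 \<le> C"
    and S: "linear S" "\<And>d. snorm (S d) \<le> C * snorm d"
    and adj: "\<And>d e. semi_inner (S d) e = semi_inner d (T e)"
  shows "sdual_comp T F \<bullet> G = F \<bullet> sdual_comp S G"
proof -
  have rep: "sdual_comp T (semi_inner_rep d) = semi_inner_rep (S d)" for d
    by (rule sdual_eqI) (simp add: sdual_comp_apply[OF T(1,2)] semi_inner_rep_apply adj)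
  obtain d where d: "(\<lambda>n. semi_inner_rep (d n)) \<longlonglongrightarrow> F" by (rule semi_inner_rep_limit)
  have "(\<lambda>n. sdual_comp T (semi_inner_rep (d n)) \<bullet> G) \<longlonglongrightarrow> sdual_comp T F \<bullet> G"
    by (intro tendsto_intros bounded_linear.tendsto[OF bounded_linear_sdual_comp[OF T] d])
  moreover have "(\<lambda>n. semi_inner_rep (d n) \<bullet> sdual_comp S G) \<longlonglongrightarrow> F \<bullet> sdual_comp S G"
    by (intro tendsto_intros d)
  ultimately show ?thesis
    by (simp add: rep inner_semi_inner_rep sdual_comp_apply[OF S] LIMSEQ_unique)
qed

section \<open>Equivalent norms and iterated squares\<close>

lemma le_of_iterated_square_bound:
  fixes r s C :: real
  assumes "0 \<le> s" and bound: "\<And>n. r ^ (2 ^ n) \<le> C * s ^ (2 ^ n)"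
  shows "r \<le> s"
proof (rule ccontr)
  assume "\<not> r \<le> s"
  then have rs: "s < r" by simp
  show False
  proof (cases "s = 0")
    case True
    then show False using bound[of 0] rs by simp
  next
    case False
    then have s: "0 < s" using assms(1) by simp
    then have "1 < r / s" using rs by simp
    then obtain m where m: "C < (r / s) ^ m" using real_arch_pow by blast
    also have "\<dots> \<le> (r / s) ^ (2 ^ m)"
      using \<open>1 < r / s\<close> by (intro power_increasing) (simp_all add: less_imp_le)
    also have "\<dots> \<le> C"
      using bound[of m] s by (simp add: power_divide divide_le_eq)
    finally show False by simp
  qed
qed

text \<open>
  The power of \<open>h\<close> with exponent \<open>2^n\<close>, formed in an algebra that need not have a unit.
\<close>

primrec iterated_square :: "nat \<Rightarrow> 'a::times \<Rightarrow> 'a" where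
  "iterated_square 0 h = h"
| "iterated_square (Suc n) h = iterated_square n h * iterated_square n h"

lemma star_iterated_square: "star h = h \<Longrightarrow> star (iterated_square n h) = iterated_square n h"
  for h :: "'a::quat_star_algebra"
  by (induction n) (simp_all add: star_mult)

lemma norm_mult_self_eq: "star h = h \<Longrightarrow> norm (h * h) = (norm h)\<^sup>2"
  for h :: "'a::quat_bstar_algebra"
  using norm_star_mult[of h] by simp

lemma norm_iterated_square: "star h = h \<Longrightarrow> norm (iterated_square n h) = norm h ^ (2 ^ n)"
  for h :: "'a::quat_bstar_algebra"
  by (induction n)
     (simp_all add: norm_mult_self_eq star_iterated_square power_mult[symmetric] mult.commute)

text \<open>
  For self-adjoint \<open>h\<close> the inequalities \<open>\<parallel>h\<parallel>^(2^n) \<le> C N(h)^(2^n)\<close> hold for all \<open>n\<close>, which removes the constant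
  \<open>C\<close>.  The general case is \<open>\<parallel>a\<parallel>\<^sup>2 = \<parallel>a\<^sup>* a\<parallel> \<le> N(a\<^sup>*) N(a) \<le> \<parallel>a\<parallel> N(a)\<close>.
\<close>

lemma norm_le_equivalent_submultiplicative:
  fixes N :: "'a::quat_bstar_algebra \<Rightarrow> real"
  assumes mult: "\<And>x y. N (x * y) \<le> N x * N y" and le: "\<And>x. N x \<le> norm x"
    and ge: "\<And>x. norm x \<le> C * N x" and nonneg: "\<And>x. 0 \<le> N x" and "0 \<le> C"
  shows "norm a \<le> N a"
proof -
  have sa: "norm h \<le> N h" if h: "star h = h" for h
  proof (rule le_of_iterated_square_bound[OF nonneg])
    fix n
    have "N (iterated_square n h) \<le> N h ^ (2 ^ n)"
    proof (induction n)
      case (Suc n)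
      then have "N (iterated_square n h) * N (iterated_square n h) \<le> N h ^ (2 ^ n) * N h ^ (2 ^ n)"
        by (intro mult_mono) (simp_all add: nonneg)
      then show ?case
        using mult[of "iterated_square n h" "iterated_square n h"]
        by (simp add: mult_2 power_add)
    qed simp
    then have "C * N (iterated_square n h) \<le> C * N h ^ (2 ^ n)"
      using \<open>0 \<le> C\<close> by (rule mult_left_mono)
    then show "norm h ^ (2 ^ n) \<le> C * N h ^ (2 ^ n)"
      using ge[of "iterated_square n h"] by (simp add: norm_iterated_square h)
  qed
  have "norm a * norm a = norm (star a * a)"
    by (simp add: norm_star_mult power2_eq_square)
  also have "\<dots> \<le> N (star a * a)"
    by (rule sa) (simp add: star_mult star_star)
  also have "\<dots> \<le> N (star a) * N a" by (rule mult)
  also have "\<dots> \<le> norm a * N a"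
    using mult_right_mono[OF le[of "star a"] nonneg] by (simp add: norm_star)
  finally show ?thesis
    by (cases "norm a = 0") (use nonneg[of a] in \<open>auto simp: mult_le_cancel_left\<close>)
qed

section \<open>The direct sum of the GNS representations\<close>

definition bstar_state :: "'a::quat_bstar_algebra \<Rightarrow> 'a \<Rightarrow> real" where
  "bstar_state a = (SOME g. linear g \<and> (\<forall>x. g (star x) = g x) \<and> (\<forall>x. 0 \<le> g (star x * x)) \<and>
    (\<forall>x. \<bar>g x\<bar> \<le> norm x) \<and> (norm a)\<^sup>2 / 4 \<le> g (star a * a))"

lemma linear_bstar_state: "linear (bstar_state a)"
  and bstar_state_star: "bstar_state a (star x) = bstar_state a x"
  and bstar_state_ge_zero: "0 \<le> bstar_state a (star x * x)"
  and abs_bstar_state_le: "\<bar>bstar_state a x\<bar> \<le> norm x"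
  and bstar_state_self_ge: "(norm a)\<^sup>2 / 4 \<le> bstar_state a (star a * a)"
  using someI_ex[OF quat_bstar_state_exists[of a], folded bstar_state_def] by auto

lemma bstar_state_add: "bstar_state a (x + y) = bstar_state a x + bstar_state a y"
  and bstar_state_scaleR: "bstar_state a (r *\<^sub>R x) = r * bstar_state a x"
  using linear_add[OF linear_bstar_state] linear_cmul[OF linear_bstar_state] by auto

lemma bstar_state_commute: "bstar_state c (star x * y) = bstar_state c (star y * x)"
  using bstar_state_star[of c "star x * y"] by (simp add: star_mult star_star)

lemma bstar_state_Cauchy_Schwarz:
  "(bstar_state c (star x * y))\<^sup>2 \<le> bstar_state c (star x * x) * bstar_state c (star y * y)"
  by (rule Cauchy_Schwarz_form[where B = "\<lambda>x y. bstar_state c (star x * y)", OF _ _ bstar_state_commute])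
     (simp_all add: star_add star_scaleR distrib_right bstar_state_add bstar_state_scaleR bstar_state_ge_zero)

text \<open>
  Iterating the Cauchy--Schwarz inequality \<open>f(y)\<^sup>2 \<le> G f(y\<^sup>2)\<close> for \<open>f(y) = g(x\<^sup>* y x)\<close> bounds
  \<open>(f(h) / G)^(2^n)\<close> by a constant times \<open>\<parallel>h\<parallel>^(2^n)\<close>, because \<open>g\<close> is bounded.
\<close>

lemma bstar_state_conjugate_le:
  fixes x :: "'a::quat_bstar_algebra"
  assumes h: "star h = h"
  shows "bstar_state c (star x * h * x) \<le> norm h * bstar_state c (star x * x)"
proof -
  define G where "G = bstar_state c (star x * x)"
  define f where "f y = bstar_state c (star x * y * x)" for y
  have square: "(f y)\<^sup>2 \<le> G * f (y * y)" if "star y = y" for y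
    using bstar_state_Cauchy_Schwarz[of c x "y * x"]
    by (simp add: f_def G_def star_mult that mult.assoc)
  have "0 \<le> G" by (simp add: G_def bstar_state_ge_zero)
  show ?thesis
  proof (cases "G = 0")
    case True
    then show ?thesis using square[OF h] by (simp add: f_def G_def)
  next
    case False
    with \<open>0 \<le> G\<close> have G: "0 < G" by simp
    have pow: "(f h / G) ^ (2 ^ n) \<le> \<bar>f (iterated_square n h)\<bar> / G" for n
    proof (induction n)
      case 0
      show ?case using G by (simp add: divide_right_mono)
    next
      case (Suc n)
      define r where "r = f (iterated_square n h)"
      \<comment> \<open>The exponent is odd only for n = 0, the one case in which the base may contribute its sign.\<close>
      have nonneg: "0 \<le> (f h / G) ^ (2 ^ n)" if "n \<noteq> 0"
        using that by (simp add: zero_le_power_eq)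
      have "(f h / G) ^ (2 ^ Suc n) = ((f h / G) ^ (2 ^ n))\<^sup>2"
        by (simp add: power_mult[symmetric] mult.commute)
      also have "\<dots> \<le> (\<bar>r\<bar> / G)\<^sup>2"
      proof (cases "n = 0")
        case True
        then show ?thesis by (simp add: r_def power_divide)
      next
        case False
        then show ?thesis using Suc nonneg by (intro power_mono) (simp_all add: r_def)
      qed
      also have "\<dots> \<le> \<bar>f (iterated_square (Suc n) h)\<bar> / G"
        using square[OF star_iterated_square[OF h], of n] G
        by (simp add: r_def power_divide power2_eq_square field_simps)
           (meson abs_ge_self mult_left_mono order_trans less_imp_le)
      finally show ?case .
    qed
    have "f h / G \<le> norm h"
    proof (rule le_of_iterated_square_bound)
      fix n
      have "\<bar>f (iterated_square n h)\<bar> \<le> norm (star x * iterated_square n h * x)"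
        unfolding f_def by (rule abs_bstar_state_le)
      also have "\<dots> \<le> norm (star x) * norm (iterated_square n h) * norm x"
        by (meson norm_mult_ineq mult_right_mono norm_ge_zero order_trans)
      also have "\<dots> = (norm x)\<^sup>2 * norm h ^ (2 ^ n)"
        by (simp add: norm_star norm_iterated_square h power2_eq_square)
      finally have "\<bar>f (iterated_square n h)\<bar> / G \<le> (norm x)\<^sup>2 * norm h ^ (2 ^ n) / G"
        using G by (intro divide_right_mono) auto
      then show "(f h / G) ^ (2 ^ n) \<le> ((norm x)\<^sup>2 / G) * norm h ^ (2 ^ n)"
        using pow[of n] by simp
    qed simp
    then show ?thesis using G by (simp add: f_def G_def field_simps)
  qed
qed

lemma bstar_state_mult_le:
  "bstar_state c (star (a * x) * (a * x)) \<le> (norm a)\<^sup>2 * bstar_state c (star x * x)"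
  using bstar_state_conjugate_le[of "star a * a" c x]
  by (simp add: star_mult star_star norm_star_mult mult.assoc)

lemma bstar_state_lact:
  "bstar_state c (star (\<alpha> \<triangleright> x) * (\<alpha> \<triangleright> x)) = (norm \<alpha>)\<^sup>2 * bstar_state c (star x * x)"
  by (simp add: star_lact ract_mult_lact lact_lact qcnj_mult_self real_lact bstar_state_scaleR
      del: of_real_power)

text \<open>
  The algebraic direct sum of copies of the algebra, indexed by its elements; the copy at \<open>c\<close> will carry the
  form of \<open>bstar_state c\<close>, a state adapted to \<open>c\<close>.
\<close>

typedef (overloaded) 'a fin_section = "{s :: 'a \<Rightarrow> 'a::real_vector. finite {c. s c \<noteq> 0}}"
  morphisms section_apply Abs_section
  by (rule exI[of _ "\<lambda>_. 0"]) simp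

setup_lifting type_definition_fin_section

lemma section_eqI: "(\<And>c. section_apply s c = section_apply t c) \<Longrightarrow> s = t"
  by (metis section_apply_inject ext)

instantiation fin_section :: (real_vector) real_vector
begin

lift_definition zero_fin_section :: "'a fin_section" is "\<lambda>_. 0" by simp
lift_definition plus_fin_section :: "'a fin_section \<Rightarrow> 'a fin_section \<Rightarrow> 'a fin_section" is "\<lambda>s t c. s c + t c"
  subgoal for s t by (rule finite_subset[of _ "{c. s c \<noteq> 0} \<union> {c. t c \<noteq> 0}"]) auto
  done
lift_definition minus_fin_section :: "'a fin_section \<Rightarrow> 'a fin_section \<Rightarrow> 'a fin_section" is "\<lambda>s t c. s c - t c"
  subgoal for s t by (rule finite_subset[of _ "{c. s c \<noteq> 0} \<union> {c. t c \<noteq> 0}"]) auto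
  done
lift_definition uminus_fin_section :: "'a fin_section \<Rightarrow> 'a fin_section" is "\<lambda>s c. - s c" by simp
lift_definition scaleR_fin_section :: "real \<Rightarrow> 'a fin_section \<Rightarrow> 'a fin_section" is "\<lambda>r s c. r *\<^sub>R s c"
  by (rule finite_subset[rotated]) auto

instance
  by standard (transfer; simp add: algebra_simps fun_eq_iff)+

end

lift_definition point_section :: "'a \<Rightarrow> 'a \<Rightarrow> 'a::real_vector fin_section" is "\<lambda>c x d. if d = c then x else 0"
  by (rule finite_subset[of _ "{_}"]) auto

lemma section_decompose:
  assumes "finite C" "\<And>c. c \<notin> C \<Longrightarrow> section_apply s c = 0"
  shows "s = (\<Sum>c\<in>C. point_section c (section_apply s c))"
proof (rule section_eqI)
  fix d
  have "section_apply (\<Sum>c\<in>C. f c) d = (\<Sum>c\<in>C. section_apply (f c) d)" for f :: "'a \<Rightarrow> 'a fin_section"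
    using \<open>finite C\<close> by (induction C) (simp_all add: zero_fin_section.rep_eq plus_fin_section.rep_eq)
  then show "section_apply s d = section_apply (\<Sum>c\<in>C. point_section c (section_apply s c)) d"
    using assms by (auto simp: point_section.rep_eq)
qed

instantiation fin_section :: (quat_bstar_algebra) semi_inner_space
begin

definition semi_inner_fin_section :: "'a fin_section \<Rightarrow> 'a fin_section \<Rightarrow> real" where
  "semi_inner_fin_section s t =
    (\<Sum>c | section_apply s c \<noteq> 0. bstar_state c (star (section_apply s c) * section_apply t c))"

lemma semi_inner_section_eq:
  assumes "finite C" "\<And>c. c \<notin> C \<Longrightarrow> section_apply s c = 0"
  shows "semi_inner s t = (\<Sum>c\<in>C. bstar_state c (star (section_apply s c) * section_apply t c))"
  unfolding semi_inner_fin_section_def using assms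
  by (intro sum.mono_neutral_left) (auto simp: star_zero linear_0[OF linear_bstar_state])

lemma finite_section_support: "finite {c. section_apply s c \<noteq> (0 :: 'a)}"
  using section_apply[of s] by simp

instance
proof
  fix x y z :: "'a fin_section" and r :: real
  define C where "C = {c. section_apply x c \<noteq> 0} \<union> {c. section_apply y c \<noteq> 0}"
  have C: "finite C" "\<And>c. c \<notin> C \<Longrightarrow> section_apply x c = 0" "\<And>c. c \<notin> C \<Longrightarrow> section_apply y c = 0"
    by (auto simp: C_def finite_section_support)
  show "semi_inner (x + y) z = semi_inner x z + semi_inner y z"
    using C by (simp add: semi_inner_section_eq[of C] plus_fin_section.rep_eq star_add distrib_right
        bstar_state_add sum.distrib)
  show "semi_inner (r *\<^sub>R x) y = r * semi_inner x y"
    using C by (simp add: semi_inner_section_eq[of C] scaleR_fin_section.rep_eq star_scaleR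
        bstar_state_scaleR sum_distrib_left)
  show "semi_inner x y = semi_inner y x"
    using C by (simp add: semi_inner_section_eq[of C] bstar_state_commute[of _ "section_apply x _"])
  show "0 \<le> semi_inner x x"
    unfolding semi_inner_fin_section_def by (intro sum_nonneg bstar_state_ge_zero)
qed

end

lift_definition mult_section :: "'a::quat_bstar_algebra \<Rightarrow> 'a fin_section \<Rightarrow> 'a fin_section"
  is "\<lambda>a s c. a * s c"
  by (rule finite_subset[rotated]) auto

lift_definition lact_section :: "quat \<Rightarrow> 'a::quat_bstar_algebra fin_section \<Rightarrow> 'a fin_section"
  is "\<lambda>\<alpha> s c. \<alpha> \<triangleright> s c"
  by (rule finite_subset[rotated]) (auto simp: lact_zero_right)

lemma linear_mult_section: "linear (mult_section a)"
  by (rule linearI; transfer; simp add: distrib_left)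

lemma linear_lact_section: "linear (lact_section \<alpha>)"
  by (rule linearI; transfer; simp add: lact_add_right lact_scaleR)

lemma snorm_section_le:
  assumes "0 \<le> C" and supp: "\<And>c. section_apply s c = 0 \<Longrightarrow> section_apply t c = 0"
    and "\<And>c. bstar_state c (star (section_apply t c) * section_apply t c)
      \<le> C\<^sup>2 * bstar_state c (star (section_apply s c) * section_apply s c)"
  shows "snorm t \<le> C * snorm s"
proof -
  define S where "S = {c. section_apply s c \<noteq> 0}"
  have S: "finite S" "\<And>c. c \<notin> S \<Longrightarrow> section_apply s c = 0" "\<And>c. c \<notin> S \<Longrightarrow> section_apply t c = 0"
    using supp by (auto simp: S_def finite_section_support)
  then have "semi_inner t t \<le> C\<^sup>2 * semi_inner s s"
    using assms(3) by (simp add: semi_inner_section_eq[of S] sum_distrib_left sum_mono)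
  then have "snorm t \<le> sqrt (C\<^sup>2 * semi_inner s s)"
    by (simp add: snorm_def)
  then show ?thesis using \<open>0 \<le> C\<close> by (simp add: real_sqrt_mult snorm_def)
qed

lemma snorm_mult_section_le: "snorm (mult_section a s) \<le> norm a * snorm s"
  by (rule snorm_section_le) (simp_all add: mult_section.rep_eq bstar_state_mult_le)

lemma snorm_lact_section_le: "snorm (lact_section \<alpha> s) \<le> norm \<alpha> * snorm s"
  by (rule snorm_section_le) (simp_all add: lact_section.rep_eq bstar_state_lact lact_zero_right)

lemma semi_inner_mult_section: "semi_inner (mult_section a s) t = semi_inner s (mult_section (star a) t)"
proof -
  define S where "S = {c. section_apply s c \<noteq> 0}"
  have "finite S" "\<And>c. c \<notin> S \<Longrightarrow> section_apply s c = 0"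
    by (auto simp: S_def finite_section_support)
  then show ?thesis
    by (simp add: semi_inner_section_eq[of S] mult_section.rep_eq star_mult mult.assoc)
qed

lemma semi_inner_lact_section:
  "semi_inner (lact_section \<alpha> s) t = semi_inner s (lact_section (qcnj \<alpha>) t)"
proof -
  define S where "S = {c. section_apply s c \<noteq> 0}"
  have "finite S" "\<And>c. c \<notin> S \<Longrightarrow> section_apply s c = 0"
    by (auto simp: S_def finite_section_support)
  then show ?thesis
    by (simp add: semi_inner_section_eq[of S] lact_section.rep_eq lact_zero_right star_lact ract_mult_lact)
qed

text \<open>
  Functionals transform by \<open>(a F)(s) = F(a\<^sup>* s)\<close>; for the functional of a vector \<open>d\<close> this is the functional of
  \<open>a d\<close>.
\<close>

definition gns_rep :: "'a::quat_bstar_algebra \<Rightarrow> 'a fin_section sdual \<Rightarrow> 'a fin_section sdual" where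
  "gns_rep a = sdual_comp (mult_section (star a))"

definition gns_lact :: "quat \<Rightarrow> 'a::quat_bstar_algebra fin_section sdual \<Rightarrow> 'a fin_section sdual" where
  "gns_lact \<alpha> = sdual_comp (lact_section (qcnj \<alpha>))"

lemma gns_rep_apply: "sdual_apply (gns_rep a F) s = sdual_apply F (mult_section (star a) s)"
  unfolding gns_rep_def by (rule sdual_comp_apply[OF linear_mult_section snorm_mult_section_le])

lemma gns_lact_apply: "sdual_apply (gns_lact \<alpha> F) s = sdual_apply F (lact_section (qcnj \<alpha>) s)"
  unfolding gns_lact_def by (rule sdual_comp_apply[OF linear_lact_section snorm_lact_section_le])

lemma bounded_linear_gns_rep: "bounded_linear (gns_rep a)"
  unfolding gns_rep_def
  by (rule bounded_linear_sdual_comp[OF linear_mult_section snorm_mult_section_le norm_ge_zero])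

lemma bounded_linear_gns_lact: "bounded_linear (gns_lact \<alpha>)"
  unfolding gns_lact_def
  by (rule bounded_linear_sdual_comp[OF linear_lact_section snorm_lact_section_le norm_ge_zero])

lemma norm_gns_rep_le: "norm (gns_rep a F) \<le> norm a * norm F"
  using norm_sdual_comp_le[OF linear_mult_section snorm_mult_section_le norm_ge_zero, of "star a" F]
  by (simp add: gns_rep_def norm_star)

lemma inner_gns_rep: "gns_rep a F \<bullet> G = F \<bullet> gns_rep (star a) G"
  unfolding gns_rep_def
  by (rule inner_sdual_comp[OF linear_mult_section snorm_mult_section_le norm_ge_zero linear_mult_section])
     (simp_all add: star_star norm_star semi_inner_mult_section
       order_trans[OF snorm_mult_section_le])

lemma inner_gns_lact: "gns_lact \<alpha> F \<bullet> G = F \<bullet> gns_lact (qcnj \<alpha>) G"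
  unfolding gns_lact_def
  by (rule inner_sdual_comp[OF linear_lact_section snorm_lact_section_le norm_ge_zero linear_lact_section])
     (use snorm_lact_section_le[of \<alpha>] in \<open>simp_all add: norm_qcnj semi_inner_lact_section\<close>)

lemma gns_rep_add: "gns_rep (a + b) F = gns_rep a F + gns_rep b F"
proof (rule sdual_eqI)
  have "mult_section (star a + star b) s = mult_section (star a) s + mult_section (star b) s" for s
    by transfer (simp add: distrib_right)
  then show "sdual_apply (gns_rep (a + b) F) s = sdual_apply (gns_rep a F + gns_rep b F) s" for s
    by (simp add: gns_rep_apply plus_sdual.rep_eq star_add linear_add[OF linear_sdual_apply])
qed

lemma gns_rep_mult: "gns_rep (a * b) F = gns_rep a (gns_rep b F)"
proof (rule sdual_eqI)
  have "mult_section (star b * star a) s = mult_section (star b) (mult_section (star a) s)" for s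
    by transfer (simp add: mult.assoc)
  then show "sdual_apply (gns_rep (a * b) F) s = sdual_apply (gns_rep a (gns_rep b F)) s" for s
    by (simp add: gns_rep_apply star_mult)
qed

lemma gns_rep_lact: "gns_rep (\<alpha> \<triangleright> a) F = gns_lact \<alpha> (gns_rep a F)"
proof (rule sdual_eqI)
  have "mult_section (star a \<triangleleft> qcnj \<alpha>) s = mult_section (star a) (lact_section (qcnj \<alpha>) s)" for s
    by transfer (simp add: ract_mult_lact)
  then show "sdual_apply (gns_rep (\<alpha> \<triangleright> a) F) s = sdual_apply (gns_lact \<alpha> (gns_rep a F)) s" for s
    by (simp add: gns_rep_apply gns_lact_apply star_lact)
qed

lemma gns_rep_ract: "gns_rep (a \<triangleleft> \<alpha>) F = gns_rep a (gns_lact \<alpha> F)"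
proof (rule sdual_eqI)
  have "mult_section (qcnj \<alpha> \<triangleright> star a) s = lact_section (qcnj \<alpha>) (mult_section (star a) s)" for s
    by transfer (simp add: lact_mult)
  then show "sdual_apply (gns_rep (a \<triangleleft> \<alpha>) F) s = sdual_apply (gns_rep a (gns_lact \<alpha> F)) s" for s
    by (simp add: gns_rep_apply gns_lact_apply star_ract)
qed

lemma qcnj_add: "qcnj (\<alpha> + \<beta>) = qcnj \<alpha> + qcnj \<beta>"
  by (simp add: qcnj_def plus_quat_def)

lemma qcnj_of_real: "qcnj (of_real r) = of_real r"
  by (simp add: qcnj_def of_real_def one_quat_def scaleR_quat_def)

lemma gns_lact_add_left: "gns_lact (\<alpha> + \<beta>) F = gns_lact \<alpha> F + gns_lact \<beta> F"
proof (rule sdual_eqI)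
  have "lact_section (\<gamma> + \<delta>) s = lact_section \<gamma> s + lact_section \<delta> s"
    for \<gamma> \<delta> and s :: "'a fin_section"
    by transfer (simp add: lact_add_left)
  then show "sdual_apply (gns_lact (\<alpha> + \<beta>) F) s = sdual_apply (gns_lact \<alpha> F + gns_lact \<beta> F) s" for s
    by (simp add: gns_lact_apply qcnj_add plus_sdual.rep_eq linear_add[OF linear_sdual_apply])
qed

lemma gns_lact_lact: "gns_lact \<alpha> (gns_lact \<beta> F) = gns_lact (\<alpha> * \<beta>) F"
proof (rule sdual_eqI)
  have "lact_section \<gamma> (lact_section \<delta> s) = lact_section (\<gamma> * \<delta>) s" for \<gamma> \<delta> and s :: "'a fin_section"
    by transfer (simp add: lact_lact)
  then show "sdual_apply (gns_lact \<alpha> (gns_lact \<beta> F)) s = sdual_apply (gns_lact (\<alpha> * \<beta>) F) s" for s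
    by (simp add: gns_lact_apply qcnj_mult)
qed

lemma gns_lact_of_real: "gns_lact (of_real r) F = r *\<^sub>R F"
proof (rule sdual_eqI)
  have "lact_section (of_real r) s = r *\<^sub>R s" for s :: "'a fin_section"
    by transfer (simp add: real_lact)
  then show "sdual_apply (gns_lact (of_real r) F) s = sdual_apply (r *\<^sub>R F) s" for s
    by (simp add: gns_lact_apply qcnj_of_real scaleR_sdual.rep_eq linear_cmul[OF linear_sdual_apply])
qed

lemma semi_inner_point_section:
  "semi_inner (point_section c x) (point_section c y) = bstar_state c (star x * y)"
  by (subst semi_inner_section_eq[of "{c}"]) (simp_all add: point_section.rep_eq)

text \<open>
  The class of a unit would be the natural test vector.  Without one, the state at \<open>c = a a\<^sup>*\<close> is tested on the vector \<open>v\<close> of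
  \<open>a\<^sup>*\<close>: it has length at most \<open>\<parallel>a\<parallel>\<close>, while its image is the vector of \<open>c\<close>, of length at least
  \<open>\<parallel>c\<parallel> / 2 = \<parallel>a\<parallel>\<^sup>2 / 2\<close>.
\<close>

lemma norm_le_onorm_gns_rep: "norm a \<le> 2 * onorm (gns_rep a)"
proof (cases "a = 0")
  case True
  then show ?thesis by (simp add: onorm_pos_le bounded_linear_gns_rep)
next
  case False
  define c where "c = a * star a"
  define v where "v = semi_inner_rep (point_section c (star a))"
  have c: "star c = c" by (simp add: c_def star_mult star_star)
  have norm_c: "norm c = (norm a)\<^sup>2"
    using norm_star_mult[of "star a"] by (simp add: c_def star_star norm_star)
  have "norm v \<le> norm a"
  proof (rule power2_le_imp_le)
    have "(norm v)\<^sup>2 = bstar_state c c"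
      by (simp add: v_def norm_semi_inner_rep snorm_power2 semi_inner_point_section star_star c_def)
    also have "\<dots> \<le> (norm a)\<^sup>2"
      using abs_bstar_state_le[of c c] by (simp add: norm_c)
    finally show "(norm v)\<^sup>2 \<le> (norm a)\<^sup>2" .
  qed simp
  have "mult_section a (point_section c (star a)) = point_section c c"
    by (rule section_eqI) (simp add: mult_section.rep_eq point_section.rep_eq c_def)
  moreover have "gns_rep a (semi_inner_rep s) = semi_inner_rep (mult_section a s)" for s
    by (rule sdual_eqI) (simp add: gns_rep_apply semi_inner_rep_apply semi_inner_mult_section)
  ultimately have "(norm (gns_rep a v))\<^sup>2 = bstar_state c (star c * c)"
    by (simp add: v_def norm_semi_inner_rep snorm_power2 semi_inner_point_section)
  then have "((norm a)\<^sup>2 / 2)\<^sup>2 \<le> (norm (gns_rep a v))\<^sup>2"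
    using bstar_state_self_ge[of c] by (simp add: norm_c power_divide)
  then have "(norm a)\<^sup>2 / 2 \<le> norm (gns_rep a v)"
    by (rule power2_le_imp_le) simp
  also have "\<dots> \<le> onorm (gns_rep a) * norm v"
    by (rule onorm[OF bounded_linear_gns_rep])
  also have "\<dots> \<le> onorm (gns_rep a) * norm a"
    using \<open>norm v \<le> norm a\<close> by (intro mult_left_mono onorm_pos_le bounded_linear_gns_rep)
  finally show ?thesis
    using False by (simp add: power2_eq_square field_simps)
qed

theorem onorm_gns_rep: "onorm (gns_rep a) = norm a"
proof (rule antisym)
  show le: "onorm (gns_rep a) \<le> norm a" for a :: 'a
    by (rule onorm_bound) (simp_all add: norm_gns_rep_le)
  have "gns_rep (x * y) = gns_rep x \<circ> gns_rep y" for x y :: 'a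
    by (simp add: fun_eq_iff gns_rep_mult)
  then have "onorm (gns_rep (x * y)) \<le> onorm (gns_rep x) * onorm (gns_rep y)" for x y :: 'a
    by (simp add: onorm_compose bounded_linear_gns_rep)
  then show "norm a \<le> onorm (gns_rep a)"
    by (rule norm_le_equivalent_submultiplicative[where C = 2])
       (simp_all add: le norm_le_onorm_gns_rep onorm_pos_le bounded_linear_gns_rep)
qed

section \<open>Tensoring with the quaternions\<close>

text \<open>
  The quadruple \<open>(x0, x1, x2, x3)\<close> stands for \<open>x0 \<otimes> 1 + x1 \<otimes> i + x2 \<otimes> j + x3 \<otimes> k\<close> in the tensor product of a real
  Hilbert space with the quaternions.  Scalars multiply the second factor from the right, operators act on the
  first, and the inner product of \<open>u \<otimes> p\<close> and \<open>v \<otimes> q\<close> is \<open>(u \<bullet> v) p\<^sup>* q\<close>.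
\<close>

type_synonym 'k quad = "'k \<times> 'k \<times> 'k \<times> 'k"

definition quad_map :: "('k \<Rightarrow> 'l) \<Rightarrow> 'k quad \<Rightarrow> 'l quad" where
  "quad_map f = (\<lambda>(x0, x1, x2, x3). (f x0, f x1, f x2, f x3))"

definition quad_ract :: "'k::real_vector quad \<Rightarrow> quat \<Rightarrow> 'k quad" where
  "quad_ract = (\<lambda>(x0, x1, x2, x3) q.
    (qRe q *\<^sub>R x0 - qIm1 q *\<^sub>R x1 - qIm2 q *\<^sub>R x2 - qIm3 q *\<^sub>R x3,
     qIm1 q *\<^sub>R x0 + qRe q *\<^sub>R x1 + qIm3 q *\<^sub>R x2 - qIm2 q *\<^sub>R x3,
     qIm2 q *\<^sub>R x0 - qIm3 q *\<^sub>R x1 + qRe q *\<^sub>R x2 + qIm1 q *\<^sub>R x3,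
     qIm3 q *\<^sub>R x0 + qIm2 q *\<^sub>R x1 - qIm1 q *\<^sub>R x2 + qRe q *\<^sub>R x3))"

definition quad_inner :: "'k::real_inner quad \<Rightarrow> 'k quad \<Rightarrow> quat" where
  "quad_inner = (\<lambda>(x0, x1, x2, x3) (y0, y1, y2, y3). Quat
    (x0 \<bullet> y0 + x1 \<bullet> y1 + x2 \<bullet> y2 + x3 \<bullet> y3)
    (x0 \<bullet> y1 - x1 \<bullet> y0 - x2 \<bullet> y3 + x3 \<bullet> y2)
    (x0 \<bullet> y2 + x1 \<bullet> y3 - x2 \<bullet> y0 - x3 \<bullet> y1)
    (x0 \<bullet> y3 - x1 \<bullet> y2 + x2 \<bullet> y1 - x3 \<bullet> y0))"

lemma qRe_quad_inner: "qRe (quad_inner x y) = x \<bullet> y"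
  by (auto simp: quad_inner_def split: prod.splits)

lemma quad_inner_self: "quad_inner x x = of_real ((norm x)\<^sup>2)"
  by (cases x) (simp add: quad_inner_def power2_norm_eq_inner of_real_def one_quat_def scaleR_quat_def
      inner_commute del: of_real_power)

lemma quad_inner_commute: "quad_inner y x = qcnj (quad_inner x y)"
  by (cases x; cases y) (simp add: quad_inner_def qcnj_def inner_commute)

lemma quad_inner_add_ract: "quad_inner x (y + quad_ract z q) = quad_inner x y + quad_inner x z * q"
  by (cases x; cases y; cases z)
     (simp add: quad_inner_def quad_ract_def quat_eq_iff plus_quat_def times_quat_def
       inner_add_right inner_diff_right algebra_simps)

lemma quad_inner_map:
  assumes "\<And>u v. f u \<bullet> v = u \<bullet> g v"
  shows "quad_inner (quad_map f x) y = quad_inner x (quad_map g y)"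
  by (cases x; cases y) (simp add: quad_inner_def quad_map_def assms)

lemma quad_ract_add_left: "quad_ract (x + y) q = quad_ract x q + quad_ract y q"
  by (cases x; cases y) (simp add: quad_ract_def algebra_simps)

lemma quad_ract_add_right: "quad_ract x (p + q) = quad_ract x p + quad_ract x q"
  by (cases x) (simp add: quad_ract_def plus_quat_def algebra_simps)

lemma quad_ract_ract: "quad_ract (quad_ract x p) q = quad_ract x (p * q)"
  by (cases x) (simp add: quad_ract_def times_quat_def algebra_simps)

lemma quad_ract_of_real: "quad_ract x (of_real r) = r *\<^sub>R x"
  by (cases x) (simp add: quad_ract_def of_real_def one_quat_def scaleR_quat_def)

lemma quad_map_ract: "linear f \<Longrightarrow> quad_map f (quad_ract x q) = quad_ract (quad_map f x) q"
  by (cases x) (simp add: quad_map_def quad_ract_def linear_add linear_diff linear_cmul)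

lemma linear_quad_map: "linear f \<Longrightarrow> linear (quad_map f)"
  by (rule linearI) (auto simp: quad_map_def linear_add linear_cmul)

lemma norm_quad: "(norm (x0, x1, x2, x3))\<^sup>2 = (norm x0)\<^sup>2 + (norm x1)\<^sup>2 + (norm x2)\<^sup>2 + (norm x3)\<^sup>2"
  by (simp add: norm_Pair)

lemma norm_quad_map_le:
  assumes "bounded_linear f"
  shows "norm (quad_map f x) \<le> onorm f * norm x"
proof (rule power2_le_imp_le)
  have *: "(norm (f u))\<^sup>2 \<le> (onorm f)\<^sup>2 * (norm u)\<^sup>2" for u
    using power_mono[OF onorm[OF assms, of u], of 2] by (simp add: power_mult_distrib)
  show "(norm (quad_map f x))\<^sup>2 \<le> (onorm f * norm x)\<^sup>2"
    by (cases x) (simp add: quad_map_def norm_quad power_mult_distrib distrib_left add_mono * del: norm_Pair)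
qed (simp add: onorm_pos_le assms)

text \<open>
  A left action \<open>\<Theta>\<close> of the quaternions on a real Hilbert space whose adjoints are given by conjugation turns the
  tensor product into a Hilbert bimodule.  The injection \<open>\<psi>\<close> transports it to a carrier inside another type.
\<close>

locale quaternionic_amplification =
  fixes \<Theta> :: "quat \<Rightarrow> 'k::{real_inner, complete_space} \<Rightarrow> 'k"
    and \<psi> :: "'k quad \<Rightarrow> 'h"
  assumes inj: "inj \<psi>"
    and bounded_linear_\<Theta>: "bounded_linear (\<Theta> \<alpha>)"
    and \<Theta>_add: "\<Theta> (\<alpha> + \<beta>) v = \<Theta> \<alpha> v + \<Theta> \<beta> v"
    and \<Theta>_mult: "\<Theta> \<alpha> (\<Theta> \<beta> v) = \<Theta> (\<alpha> * \<beta>) v"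
    and \<Theta>_of_real: "\<Theta> (of_real r) v = r *\<^sub>R v"
    and \<Theta>_adjoint: "\<Theta> \<alpha> u \<bullet> v = u \<bullet> \<Theta> (qcnj \<alpha>) v"
begin

abbreviation unpsi :: "'h \<Rightarrow> 'k quad" where "unpsi \<equiv> inv \<psi>"

lemma unpsi [simp]: "unpsi (\<psi> x) = x"
  by (rule inv_f_f[OF inj])

lemma psi_eq_iff [simp]: "\<psi> x = \<psi> y \<longleftrightarrow> x = y"
  using inj by (simp add: inj_eq)

definition H :: "'h quat_bimodule" where
  "H = \<lparr>hcarrier = range \<psi>, hzero = \<psi> 0, hadd = (\<lambda>x y. \<psi> (unpsi x + unpsi y)),
    hlact = (\<lambda>\<alpha> x. \<psi> (quad_map (\<Theta> \<alpha>) (unpsi x))), hract = (\<lambda>x \<alpha>. \<psi> (quad_ract (unpsi x) \<alpha>)),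
    hinner = (\<lambda>x y. quad_inner (unpsi x) (unpsi y))\<rparr>"

lemma H_simps [simp]:
  "hcarrier H = range \<psi>" "hzero H = \<psi> 0" "hadd H (\<psi> x) (\<psi> y) = \<psi> (x + y)"
  "hlact H \<alpha> (\<psi> x) = \<psi> (quad_map (\<Theta> \<alpha>) x)" "hract H (\<psi> x) \<alpha> = \<psi> (quad_ract x \<alpha>)"
  "hinner H (\<psi> x) (\<psi> y) = quad_inner x y"
  by (simp_all add: H_def)

lemma quad_map_of_real: "quad_map (\<Theta> (of_real r)) x = r *\<^sub>R x"
  by (cases x) (simp add: quad_map_def \<Theta>_of_real)

lemma hnorm_H [simp]: "hnorm H (\<psi> x) = norm x"
  by (simp add: hnorm_def quad_inner_self del: of_real_power)

lemma hdist_H: "hdist H x y = dist (unpsi x) (unpsi y)"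
proof -
  have "hdist H x y = hnorm H (\<psi> (unpsi x + quad_map (\<Theta> (- 1)) (unpsi y)))"
    by (simp add: hdist_def H_def)
  also have "\<dots> = dist (unpsi x) (unpsi y)"
    using quad_map_of_real[of "-1" "unpsi y"] by (simp add: dist_norm)
  finally show ?thesis .
qed

lemma Metric_space_H: "Metric_space (range \<psi>) (hdist H)"
  by unfold_locales (auto simp: hdist_H dist_commute dist_triangle)

lemma mcomplete_H: "Metric_space.mcomplete (hcarrier H) (hdist H)"
proof -
  interpret Metric_space "range \<psi>" "hdist H" by (rule Metric_space_H)
  have "\<exists>x. limitin mtopology \<sigma> x sequentially" if \<sigma>: "MCauchy \<sigma>" for \<sigma>
  proof -
    have "Cauchy (\<lambda>n. unpsi (\<sigma> n))"
      using \<sigma> unfolding MCauchy_def Cauchy_def hdist_H by metis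
    then obtain l where l: "(\<lambda>n. unpsi (\<sigma> n)) \<longlonglongrightarrow> l"
      using Cauchy_convergent convergent_def by blast
    have "\<sigma> n \<in> range \<psi>" for n
      using \<sigma> by (auto simp: MCauchy_def)
    then have "limitin mtopology \<sigma> (\<psi> l) sequentially"
      using l by (auto simp: limitin_metric hdist_H tendsto_iff)
    then show ?thesis by blast
  qed
  then show ?thesis by (simp add: mcomplete_def)
qed

lemma hilbert_quat_bimodule_H: "hilbert_quat_bimodule H"
proof
  note lin = bounded_linear.linear[OF bounded_linear_\<Theta>]
  fix x y z \<alpha> \<beta> r
  show "hzero H \<in> hcarrier H" by simp
  { assume x: "x \<in> hcarrier H"
    then obtain x' where x': "x = \<psi> x'" by auto
    show "hlact H \<alpha> x \<in> hcarrier H" "hract H x \<alpha> \<in> hcarrier H" "hadd H (hzero H) x = x"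
      by (simp_all add: x')
    show "\<exists>y\<in>hcarrier H. hadd H y x = hzero H"
      by (rule bexI[of _ "\<psi> (- x')"]) (simp_all add: x')
    show "hlact H (\<alpha> + \<beta>) x = hadd H (hlact H \<alpha> x) (hlact H \<beta> x)"
      by (cases x') (simp add: x' quad_map_def \<Theta>_add)
    show "hlact H \<alpha> (hlact H \<beta> x) = hlact H (\<alpha> * \<beta>) x"
      by (cases x') (simp add: x' quad_map_def \<Theta>_mult)
    show "hlact H 1 x = x" "hract H x 1 = x"
      using quad_map_of_real[of 1 x'] quad_ract_of_real[of x' 1] by (simp_all add: x')
    show "hract H x (\<alpha> + \<beta>) = hadd H (hract H x \<alpha>) (hract H x \<beta>)"
      by (simp add: x' quad_ract_add_right)
    show "hract H (hract H x \<alpha>) \<beta> = hract H x (\<alpha> * \<beta>)"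
      by (simp add: x' quad_ract_ract)
    show "hract H (hlact H \<alpha> x) \<beta> = hlact H \<alpha> (hract H x \<beta>)"
      by (simp add: x' quad_map_ract lin)
    show "hlact H (of_real r) x = hract H x (of_real r)"
      by (simp add: x' quad_map_of_real quad_ract_of_real)
    show "\<exists>r\<ge>0. hinner H x x = of_real r"
      by (auto simp: x' quad_inner_self simp del: of_real_power)
    show "x = hzero H" if "hinner H x x = 0"
      using that by (simp add: x' quad_inner_self)
    assume "y \<in> hcarrier H"
    then obtain y' where y': "y = \<psi> y'" by auto
    show "hadd H x y \<in> hcarrier H" "hadd H x y = hadd H y x"
      by (simp_all add: x' y' add.commute)
    show "hlact H \<alpha> (hadd H x y) = hadd H (hlact H \<alpha> x) (hlact H \<alpha> y)"
      by (simp add: x' y' linear_add[OF linear_quad_map[OF lin]])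
    show "hract H (hadd H x y) \<alpha> = hadd H (hract H x \<alpha>) (hract H y \<alpha>)"
      by (simp add: x' y' quad_ract_add_left)
    show "hinner H y x = qcnj (hinner H x y)"
      by (simp add: x' y' quad_inner_commute[of y'])
    show "hinner H (hlact H \<alpha> x) y = hinner H x (hlact H (qcnj \<alpha>) y)"
      by (simp add: x' y' quad_inner_map[OF \<Theta>_adjoint])
    assume "z \<in> hcarrier H"
    then obtain z' where z': "z = \<psi> z'" by auto
    show "hadd H (hadd H x y) z = hadd H x (hadd H y z)"
      by (simp add: x' y' z' add.assoc)
    show "hinner H x (hadd H y (hract H z \<beta>)) = hinner H x y + hinner H x z * \<beta>"
      by (simp add: x' y' z' quad_inner_add_ract) }
  show "Metric_space.mcomplete (hcarrier H) (hdist H)"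
    by (rule mcomplete_H)
qed

definition amp :: "('k \<Rightarrow> 'k) \<Rightarrow> 'h \<Rightarrow> 'h" where
  "amp T = (\<lambda>x\<in>range \<psi>. \<psi> (quad_map T (unpsi x)))"

lemma amp_apply [simp]: "amp T (\<psi> x) = \<psi> (quad_map T x)"
  by (simp add: amp_def)

lemma amp_eqI:
  assumes "f \<in> extensional (range \<psi>)" "\<And>x. f (\<psi> x) = \<psi> (quad_map T x)"
  shows "f = amp T"
  using assms by (intro extensionalityI[of f "range \<psi>"]) (auto simp: amp_def)

lemma amp_closed:
  assumes T: "bounded_linear T"
  shows "amp T \<in> LR_carrier H"
proof -
  note lin = linear_quad_map[OF bounded_linear.linear[OF T]]
  have "amp T \<in> hcarrier H \<rightarrow>\<^sub>E hcarrier H"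
    by (auto simp: amp_def)
  moreover have "\<exists>K. \<forall>x\<in>hcarrier H. hnorm H (amp T x) \<le> K * hnorm H x"
    using norm_quad_map_le[OF T] by (intro exI[of _ "onorm T"]) auto
  ultimately show ?thesis
    by (simp add: LR_carrier_def quad_map_of_real linear_add[OF lin] linear_cmul[OF lin]
        del: split_paired_All)
qed

lemma amp_add: "LR_add H (amp S) (amp T) = amp (\<lambda>v. S v + T v)"
  by (rule amp_eqI) (auto simp: LR_add_def quad_map_def split: prod.splits)

lemma amp_mult: "LR_mult H (amp S) (amp T) = amp (\<lambda>v. S (T v))"
  by (rule amp_eqI) (auto simp: LR_mult_def compose_def quad_map_def split: prod.splits)

lemma LR_Theta_eq_amp: "LR_Theta H \<alpha> = amp (\<Theta> \<alpha>)"
  by (rule amp_eqI) (auto simp: LR_Theta_def)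

text \<open>
  The real inner product determines the value of an adjoint at every vector, hence an adjoint on the carrier is
  unique.
\<close>

lemma LR_adjoint_amp:
  assumes S: "bounded_linear S" and adj: "\<And>u v. T u \<bullet> v = u \<bullet> S v"
  shows "LR_adjoint H (amp T) = amp S"
  unfolding LR_adjoint_def
proof (rule the_equality)
  show "amp S \<in> LR_carrier H \<and> (\<forall>x\<in>hcarrier H. \<forall>y\<in>hcarrier H.
      qRe (hinner H (amp T x) y) = qRe (hinner H x (amp S y)))"
    using amp_closed[OF S] quad_inner_map[OF adj] by auto
next
  fix R
  assume R: "R \<in> LR_carrier H \<and> (\<forall>x\<in>hcarrier H. \<forall>y\<in>hcarrier H.
      qRe (hinner H (amp T x) y) = qRe (hinner H x (R y)))"
  show "R = amp S"
  proof (rule amp_eqI)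
    show "R \<in> extensional (range \<psi>)"
      using R by (auto simp: LR_carrier_def PiE_def)
    fix y
    have "R (\<psi> y) \<in> range \<psi>"
      using R by (auto simp: LR_carrier_def PiE_def Pi_def)
    then obtain z where z: "R (\<psi> y) = \<psi> z" by auto
    have "x \<bullet> z = x \<bullet> quad_map S y" for x
    proof -
      have "qRe (hinner H (amp T (\<psi> x)) (\<psi> y)) = qRe (hinner H (\<psi> x) (R (\<psi> y)))"
        by (rule R[THEN conjunct2, rule_format]) simp_all
      then show ?thesis
        by (simp add: z quad_inner_map[OF adj] qRe_quad_inner)
    qed
    then show "R (\<psi> y) = \<psi> (quad_map S y)"
      using vector_eq_rdot[of z "quad_map S y"] by (simp add: z inner_commute)
  qed
qed

lemma LR_norm_amp:
  assumes T: "bounded_linear T"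
  shows "LR_norm H (amp T) = onorm T"
proof -
  define A where "A = {hnorm H (amp T x) | x. x \<in> hcarrier H \<and> hnorm H x \<le> 1}"
  have A: "A = {norm (quad_map T x) | x. norm x \<le> 1}"
  proof (intro subset_antisym subsetI)
    fix a assume "a \<in> A"
    then obtain y where y: "y \<in> range \<psi>" "hnorm H y \<le> 1" "a = hnorm H (amp T y)"
      unfolding A_def by force
    from y(1) obtain x where "y = \<psi> x" by blast
    with y show "a \<in> {norm (quad_map T x) | x. norm x \<le> 1}"
      unfolding mem_Collect_eq by (intro exI[of _ x]) simp
  next
    fix a assume "a \<in> {norm (quad_map T x) | x. norm x \<le> 1}"
    then have "\<exists>x. a = norm (quad_map T x) \<and> norm x \<le> 1" by (rule CollectD)
    then obtain x where "a = norm (quad_map T x)" "norm x \<le> 1" by (elim exE conjE)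
    then show "a \<in> A"
      unfolding A_def mem_Collect_eq by (intro exI[of _ "\<psi> x"]) simp
  qed
  have le: "a \<le> onorm T" if "a \<in> A" for a
  proof -
    have "\<exists>x. a = norm (quad_map T x) \<and> norm x \<le> 1"
      using that unfolding A by (rule CollectD)
    then obtain x where x: "a = norm (quad_map T x)" "norm x \<le> 1" by (elim exE conjE)
    then show ?thesis
      using norm_quad_map_le[OF T, of x] mult_left_mono[OF x(2) onorm_pos_le[OF T]] by simp
  qed
  then have bdd: "bdd_above A" by (rule bdd_aboveI)
  have zero: "0 \<in> A"
    unfolding A mem_Collect_eq
    using linear_0[OF linear_quad_map[OF bounded_linear.linear[OF T]]]
    by (intro exI[of _ 0]) (simp only: norm_zero zero_le_one simp_thms)
  have "onorm T \<le> Sup A"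
  proof (rule onorm_bound)
    show "0 \<le> Sup A" using cSup_upper[OF zero bdd] .
    fix v
    show "norm (T v) \<le> Sup A * norm v"
    proof (cases "v = 0")
      case True
      then show ?thesis using linear_0[OF bounded_linear.linear[OF T]] by simp
    next
      case False
      define w where "w = (1 / norm v) *\<^sub>R v"
      have "T 0 = 0" by (rule linear_0[OF bounded_linear.linear[OF T]])
      then have "norm (T w) = norm (quad_map T (w, 0, 0, 0))"
        by (simp add: quad_map_def norm_Pair)
      moreover have "norm (w, 0 :: 'k, 0 :: 'k, 0 :: 'k) \<le> 1"
        using False by (simp add: norm_Pair w_def)
      ultimately have "norm (T w) \<in> A" by (auto simp: A)
      then have "norm (T w) \<le> Sup A" using bdd by (rule cSup_upper)
      then show ?thesis
        using False by (simp add: w_def linear_cmul[OF bounded_linear.linear[OF T]] field_simps)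
    qed
  qed
  moreover have "Sup A \<le> onorm T"
    using zero le by (intro cSup_least) auto
  ultimately show ?thesis
    by (simp add: LR_norm_def A_def)
qed

end

text \<open>
  A functional on sections is determined by its values on sections supported at one index, so a quadruple of
  them is a function of an index and an element.
\<close>

definition quad_embed :: "'a::quat_bstar_algebra fin_section sdual quad \<Rightarrow> 'a \<Rightarrow> 'a \<Rightarrow> quat" where
  "quad_embed = (\<lambda>(F0, F1, F2, F3) c x. Quat (sdual_apply F0 (point_section c x))
    (sdual_apply F1 (point_section c x)) (sdual_apply F2 (point_section c x))
    (sdual_apply F3 (point_section c x)))"

lemma sdual_eqI_point_section:
  fixes F G :: "'a::quat_bstar_algebra fin_section sdual"
  assumes "\<And>c x. sdual_apply F (point_section c x) = sdual_apply G (point_section c x)"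
  shows "F = G"
proof (rule sdual_eqI)
  fix s :: "'a fin_section"
  have s: "s = (\<Sum>c | section_apply s c \<noteq> 0. point_section c (section_apply s c))"
    by (rule section_decompose) (auto simp: finite_section_support)
  show "sdual_apply F s = sdual_apply G s"
    by (subst (1 2) s) (simp add: linear_sum[OF linear_sdual_apply] assms)
qed

lemma inj_quad_embed: "inj quad_embed"
proof (rule injI)
  fix x y :: "'a fin_section sdual quad"
  assume "quad_embed x = quad_embed y"
  then show "x = y"
    by (cases x; cases y) (auto simp: quad_embed_def fun_eq_iff intro!: sdual_eqI_point_section)
qed

section \<open>The representation theorem\<close>

theorem corollary4p6:
  shows "\<exists>(H :: ('a :: quat_bstar_algebra \<Rightarrow> 'a \<Rightarrow> quat) quat_bimodule) (\<phi> :: 'a \<Rightarrow> _).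
    hilbert_quat_bimodule H \<and> quat_star_hom_LR H \<phi> \<and> (\<forall>a. LR_norm H (\<phi> a) = norm a)"
proof -
  interpret quaternionic_amplification gns_lact
    "quad_embed :: 'a fin_section sdual quad \<Rightarrow> 'a \<Rightarrow> 'a \<Rightarrow> quat"
    by (rule quaternionic_amplification.intro)
       (simp_all add: inj_quad_embed bounded_linear_gns_lact gns_lact_add_left gns_lact_lact
         gns_lact_of_real inner_gns_lact)
  have "quat_star_hom_LR H (\<lambda>a. amp (gns_rep a))"
  proof
    fix a b :: 'a and \<alpha>
    show "amp (gns_rep a) \<in> LR_carrier H"
      by (rule amp_closed[OF bounded_linear_gns_rep])
    show "amp (gns_rep (a + b)) = LR_add H (amp (gns_rep a)) (amp (gns_rep b))"
      by (simp add: amp_add flip: gns_rep_add)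
    show "amp (gns_rep (\<alpha> \<triangleright> a)) = LR_lact H \<alpha> (amp (gns_rep a))"
      by (simp add: LR_lact_def LR_Theta_eq_amp amp_mult flip: gns_rep_lact)
    show "amp (gns_rep (a \<triangleleft> \<alpha>)) = LR_ract H (amp (gns_rep a)) \<alpha>"
      by (simp add: LR_ract_def LR_Theta_eq_amp amp_mult flip: gns_rep_ract)
    show "amp (gns_rep (a * b)) = LR_mult H (amp (gns_rep a)) (amp (gns_rep b))"
      by (simp add: amp_mult flip: gns_rep_mult)
    show "amp (gns_rep (star a)) = LR_adjoint H (amp (gns_rep a))"
      by (rule LR_adjoint_amp[OF bounded_linear_gns_rep inner_gns_rep, symmetric])
  qed
  moreover have "LR_norm H (amp (gns_rep a)) = norm a" for a
    by (simp add: LR_norm_amp[OF bounded_linear_gns_rep] onorm_gns_rep)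
  ultimately show ?thesis
    using hilbert_quat_bimodule_H by blast
qed

end
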